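(* Over a field of characteristic $0$, every multilinear polynomial identity of degree $5$ relating the special commutator $[x,y,z]=xyz-yxz$ and the special translator $\langle x,y,z\rangle=xyz-yzx$ in every associative triple system follows from the comtrans identities $$[x,y,z]+[y,x,z]=0,\quad \langle x,y,z\rangle+\langle y,z,x\rangle+\langle z,x,y\rangle=0,\quad [x,y,z]+[z,y,x]=\langle x,y,z\rangle+\langle z,y,x\rangle,$$ the commutator identity $$T_{x,z}(v,w,y)+T_{x,z}(w,y,v)+T_{x,z}(y,v,w)=0,\qquad T_{x,z}(v,w,y)=[[v,w,x],y,z]-[v,w,[x,y,z]],$$ the translator identity $$R_{y,z}(\langle v,w,x\rangle)=\langle R_{y,z}(v),w,x\rangle+\langle v,R_{y,z}(w),x\rangle+\langle v,w,R_{y,z}(x)\rangle,\qquad R_{y,z}(u)=\langle u,y,z\rangle,$$ and the following identities involving both operations (commas between arguments omitted): \begin{align*} &[[vwx]yz]+[[xvy]wz]-[\langle vwx\rangle yz]+[\langle vyw\rangle xz]-[\langle xyw\rangle vz]=0,\\ &[[vwx]yz]-[[vyw]xz]+\langle[wvz]xy\rangle+[\langle vyw\rangle xz]+[vw\langle zxy\rangle]=0,\\ &[[vwx]yz]+[[vwz]xy]-[[xwy]vz]-[[zwy]xv]+\langle[wvz]xy\rangle+\langle[xwz]yv\rangle+\langle[zwy]xv\rangle\\ &\quad+[\langle wvx\rangle yz]+[\langle wvz\rangle xy]-[\langle wyv\rangle xz]-\langle\langle wvz\rangle xy\rangle+\langle\langle wyv\rangle xz\rangle+\langle wx\langle zyv\rangle\rangle=0.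 \end{align*}
   Context: An associative triple system is a vector space $A$ with a trilinear operation $(x,y,z)\mapsto xyz$ satisfying $((vwx)yz)=(v(wxy)z)=(vw(xyz))$. Multilinear identities of degree $n$ are elements of the multilinear part of degree $n$ (on $n$ distinct variables) of the free algebra with two trilinear operations $[-,-,-]$ and $\langle-,-,-\rangle$ with no symmetry; such an element is an identity satisfied by the special commutator and translator if it becomes $0$ when the operations are replaced by $xyz-yxz$ and $xyz-yzx$ in every associative triple system. An identity follows from a set of identities if it belongs to the operadic ideal they generate, i.e. it is a linear combination of identities obtained from the given ones by permuting variables, substituting monomials for variables, and inserting the identities as arguments into either operation. *)

theory Defs
  imports Complex_Main "HOL-Library.Poly_Mapping"
begin

section \<open>Formal linear combinations\<close>

definition pm_scale :: "'k::field \<Rightarrow> ('b \<Rightarrow>\<^sub>0 'k) \<Rightarrow> ('b \<Rightarrow>\<^sub>0 'k)" where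
  "pm_scale c f = Poly_Mapping.map ((*) c) f"

lemma lookup_pm_scale [simp]:
  "Poly_Mapping.lookup (pm_scale c f) b = c * Poly_Mapping.lookup f b"
  by (simp add: pm_scale_def Poly_Mapping.map.rep_eq when_def)

global_interpretation pm: vector_space pm_scale
  by unfold_locales (auto intro!: poly_mapping_eqI simp: lookup_add algebra_simps)

text \<open>The linear extension to formal linear combinations of a map given on the basis; \<open>scale\<close> is
  the scalar multiplication of the target space.\<close>
definition lin_ext ::
  "('k::field \<Rightarrow> 'a::ab_group_add \<Rightarrow> 'a) \<Rightarrow> ('b \<Rightarrow> 'a) \<Rightarrow> ('b \<Rightarrow>\<^sub>0 'k) \<Rightarrow> 'a" where
  "lin_ext scale \<phi> f = (\<Sum>b\<in>Poly_Mapping.keys f. scale (Poly_Mapping.lookup f b) (\<phi> b))"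

definition trilin_ext :: "('b \<Rightarrow> 'b \<Rightarrow> 'b \<Rightarrow> 'b) \<Rightarrow>
    ('b \<Rightarrow>\<^sub>0 'k::field) \<Rightarrow> ('b \<Rightarrow>\<^sub>0 'k) \<Rightarrow> ('b \<Rightarrow>\<^sub>0 'k) \<Rightarrow> ('b \<Rightarrow>\<^sub>0 'k)" where
  "trilin_ext p f g h =
     lin_ext pm_scale (\<lambda>a. lin_ext pm_scale (\<lambda>b. lin_ext pm_scale
       (\<lambda>c. Poly_Mapping.single (p a b c) 1) h) g) f"


section \<open>The free algebra with two trilinear operations\<close>

text \<open>Monomials in the variables indexed by the natural numbers. \<open>Com\<close> stands for the operation
  written \<open>[-,-,-]\<close> and \<open>Tra\<close> for the operation written \<open>\<langle>-,-,-\<rangle>\<close>; no symmetry is imposed.\<close>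
datatype monomial = Var nat | Com monomial monomial monomial | Tra monomial monomial monomial

type_synonym 'k ct_poly = "monomial \<Rightarrow>\<^sub>0 'k"

abbreviation mon :: "monomial \<Rightarrow> 'k::field ct_poly" where
  "mon t \<equiv> Poly_Mapping.single t 1"

definition com :: "'k::field ct_poly \<Rightarrow> 'k ct_poly \<Rightarrow> 'k ct_poly \<Rightarrow> 'k ct_poly" ("[_,/ _,/ _]\<^sub>c")
  where "[f, g, h]\<^sub>c = trilin_ext Com f g h"

definition tra :: "'k::field ct_poly \<Rightarrow> 'k ct_poly \<Rightarrow> 'k ct_poly \<Rightarrow> 'k ct_poly" ("\<langle>_,/ _,/ _\<rangle>")
  where "\<langle>f, g, h\<rangle> = trilin_ext Tra f g h"

primrec leaves :: "monomial \<Rightarrow> nat list" where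
  "leaves (Var i) = [i]"
| "leaves (Com r s t) = leaves r @ leaves s @ leaves t"
| "leaves (Tra r s t) = leaves r @ leaves s @ leaves t"

text \<open>Every monomial contains each variable of \<open>X\<close> exactly once and no other variable; the
  multilinear part of degree \<open>n\<close> is obtained for \<open>card X = n\<close>.\<close>
definition multilinear_on :: "nat set \<Rightarrow> 'k::field ct_poly \<Rightarrow> bool" where
  "multilinear_on X f \<longleftrightarrow> (\<forall>t\<in>Poly_Mapping.keys f. distinct (leaves t) \<and> set (leaves t) = X)"

definition multilinear :: "'k::field ct_poly \<Rightarrow> bool" where
  "multilinear f \<longleftrightarrow> (\<exists>X. multilinear_on X f)"

primrec mono_subst :: "(nat \<Rightarrow> monomial) \<Rightarrow> monomial \<Rightarrow> monomial" where
  "mono_subst \<sigma> (Var i) = \<sigma> i"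
| "mono_subst \<sigma> (Com r s t) = Com (mono_subst \<sigma> r) (mono_subst \<sigma> s) (mono_subst \<sigma> t)"
| "mono_subst \<sigma> (Tra r s t) = Tra (mono_subst \<sigma> r) (mono_subst \<sigma> s) (mono_subst \<sigma> t)"

definition ct_subst :: "(nat \<Rightarrow> monomial) \<Rightarrow> 'k::field ct_poly \<Rightarrow> 'k ct_poly" where
  "ct_subst \<sigma> f = lin_ext pm_scale (\<lambda>t. mon (mono_subst \<sigma> t)) f"

text \<open>The multilinear elements obtained from \<open>G\<close> by substituting monomials for variables
  (permutations and renamings of variables being the case \<open>\<sigma> = Var \<circ> \<pi>\<close>) and by inserting into
  either operation, the other two arguments being monomials.\<close>
inductive_set consequences :: "'k::field ct_poly set \<Rightarrow> 'k ct_poly set"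
  for G :: "'k::field ct_poly set" where
  base: "g \<in> G \<Longrightarrow> g \<in> consequences G"
| subst: "g \<in> consequences G \<Longrightarrow> multilinear (ct_subst \<sigma> g) \<Longrightarrow> ct_subst \<sigma> g \<in> consequences G"
| com1: "g \<in> consequences G \<Longrightarrow> multilinear [g, mon s, mon t]\<^sub>c \<Longrightarrow> [g, mon s, mon t]\<^sub>c \<in> consequences G"
| com2: "g \<in> consequences G \<Longrightarrow> multilinear [mon s, g, mon t]\<^sub>c \<Longrightarrow> [mon s, g, mon t]\<^sub>c \<in> consequences G"
| com3: "g \<in> consequences G \<Longrightarrow> multilinear [mon s, mon t, g]\<^sub>c \<Longrightarrow> [mon s, mon t, g]\<^sub>c \<in> consequences G"
| tra1: "g \<in> consequences G \<Longrightarrow> multilinear \<langle>g, mon s, mon t\<rangle> \<Longrightarrow> \<langle>g, mon s, mon t\<rangle> \<in> consequences G"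
| tra2: "g \<in> consequences G \<Longrightarrow> multilinear \<langle>mon s, g, mon t\<rangle> \<Longrightarrow> \<langle>mon s, g, mon t\<rangle> \<in> consequences G"
| tra3: "g \<in> consequences G \<Longrightarrow> multilinear \<langle>mon s, mon t, g\<rangle> \<Longrightarrow> \<langle>mon s, mon t, g\<rangle> \<in> consequences G"

definition follows_from :: "'k::field ct_poly set \<Rightarrow> 'k ct_poly \<Rightarrow> bool" where
  "follows_from G f \<longleftrightarrow> f \<in> pm.span (consequences G)"


section \<open>Associative triple systems and their special operations\<close>

locale assoc_triple_system = vector_space scale
  for scale :: "'k::field \<Rightarrow> 'a::ab_group_add \<Rightarrow> 'a" +
  fixes triple :: "'a \<Rightarrow> 'a \<Rightarrow> 'a \<Rightarrow> 'a"
  assumes add_left: "triple (x + x') y z = triple x y z + triple x' y z"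
    and add_middle: "triple x (y + y') z = triple x y z + triple x y' z"
    and add_right: "triple x y (z + z') = triple x y z + triple x y z'"
    and scale_left: "triple (scale c x) y z = scale c (triple x y z)"
    and scale_middle: "triple x (scale c y) z = scale c (triple x y z)"
    and scale_right: "triple x y (scale c z) = scale c (triple x y z)"
    and assoc_left: "triple (triple v w x) y z = triple v (triple w x y) z"
    and assoc_right: "triple v (triple w x y) z = triple v w (triple x y z)"

definition special_commutator ::
  "('a \<Rightarrow> 'a \<Rightarrow> 'a \<Rightarrow> 'a::ab_group_add) \<Rightarrow> 'a \<Rightarrow> 'a \<Rightarrow> 'a \<Rightarrow> 'a" where
  "special_commutator triple x y z = triple x y z - triple y x z"

definition special_translator ::
  "('a \<Rightarrow> 'a \<Rightarrow> 'a \<Rightarrow> 'a::ab_group_add) \<Rightarrow> 'a \<Rightarrow> 'a \<Rightarrow> 'a \<Rightarrow> 'a" where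
  "special_translator triple x y z = triple x y z - triple y z x"

primrec mono_eval ::
  "('a \<Rightarrow> 'a \<Rightarrow> 'a \<Rightarrow> 'a::ab_group_add) \<Rightarrow> (nat \<Rightarrow> 'a) \<Rightarrow> monomial \<Rightarrow> 'a" where
  "mono_eval triple \<rho> (Var i) = \<rho> i"
| "mono_eval triple \<rho> (Com r s t) =
     special_commutator triple (mono_eval triple \<rho> r) (mono_eval triple \<rho> s) (mono_eval triple \<rho> t)"
| "mono_eval triple \<rho> (Tra r s t) =
     special_translator triple (mono_eval triple \<rho> r) (mono_eval triple \<rho> s) (mono_eval triple \<rho> t)"

definition ct_eval :: "('k::field \<Rightarrow> 'a::ab_group_add \<Rightarrow> 'a) \<Rightarrow> ('a \<Rightarrow> 'a \<Rightarrow> 'a \<Rightarrow> 'a) \<Rightarrow>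
    (nat \<Rightarrow> 'a) \<Rightarrow> 'k ct_poly \<Rightarrow> 'a" where
  "ct_eval scale triple \<rho> f = lin_ext scale (mono_eval triple \<rho>) f"

text \<open>\<open>f\<close> is an identity of the special commutator and translator in every associative triple
  system with underlying type \<open>'a\<close>. The type \<open>nat list \<Rightarrow>\<^sub>0 'k\<close> carries the free associative triple
  system, and so identities over that type hold over every type, as shown in
  \<open>special_identity_universal\<close> below.\<close>
definition special_identity :: "'a::ab_group_add itself \<Rightarrow> 'k::field ct_poly \<Rightarrow> bool" where
  "special_identity (_ :: 'a itself) f \<longleftrightarrow>
     (\<forall>(scale :: 'k \<Rightarrow> 'a \<Rightarrow> 'a) triple. assoc_triple_system scale triple \<longrightarrow>
        (\<forall>\<rho>. ct_eval scale triple \<rho> f = 0))"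


section \<open>The identities\<close>

definition ct_T :: "'k::field ct_poly \<Rightarrow> 'k ct_poly \<Rightarrow> 'k ct_poly \<Rightarrow> 'k ct_poly \<Rightarrow> 'k ct_poly \<Rightarrow> 'k ct_poly"
  where "ct_T x z v w y = [[v, w, x]\<^sub>c, y, z]\<^sub>c - [v, w, [x, y, z]\<^sub>c]\<^sub>c"

definition ct_R :: "'k::field ct_poly \<Rightarrow> 'k ct_poly \<Rightarrow> 'k ct_poly \<Rightarrow> 'k ct_poly"
  where "ct_R y z u = \<langle>u, y, z\<rangle>"

text \<open>An identity \<open>l = r\<close> is represented by the element \<open>l - r\<close>.\<close>
definition comtrans_identities :: "'k::field ct_poly set" where
  "comtrans_identities =
    (let x = mon (Var 0); y = mon (Var 1); z = mon (Var 2) in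
     {[x, y, z]\<^sub>c + [y, x, z]\<^sub>c,
      \<langle>x, y, z\<rangle> + \<langle>y, z, x\<rangle> + \<langle>z, x, y\<rangle>,
      ([x, y, z]\<^sub>c + [z, y, x]\<^sub>c) - (\<langle>x, y, z\<rangle> + \<langle>z, y, x\<rangle>)})"

definition commutator_identity :: "'k::field ct_poly" where
  "commutator_identity =
    (let v = mon (Var 0); w = mon (Var 1); x = mon (Var 2); y = mon (Var 3); z = mon (Var 4) in
     ct_T x z v w y + ct_T x z w y v + ct_T x z y v w)"

definition translator_identity :: "'k::field ct_poly" where
  "translator_identity =
    (let v = mon (Var 0); w = mon (Var 1); x = mon (Var 2); y = mon (Var 3); z = mon (Var 4) in
     ct_R y z \<langle>v, w, x\<rangle>
       - (\<langle>ct_R y z v, w, x\<rangle> + \<langle>v, ct_R y z w, x\<rangle> + \<langle>v, w, ct_R y z x\<rangle>))"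

definition mixed_identities :: "'k::field ct_poly set" where
  "mixed_identities =
    (let v = mon (Var 0); w = mon (Var 1); x = mon (Var 2); y = mon (Var 3); z = mon (Var 4) in
     {[[v, w, x]\<^sub>c, y, z]\<^sub>c + [[x, v, y]\<^sub>c, w, z]\<^sub>c - [\<langle>v, w, x\<rangle>, y, z]\<^sub>c
        + [\<langle>v, y, w\<rangle>, x, z]\<^sub>c - [\<langle>x, y, w\<rangle>, v, z]\<^sub>c,
      [[v, w, x]\<^sub>c, y, z]\<^sub>c - [[v, y, w]\<^sub>c, x, z]\<^sub>c + \<langle>[w, v, z]\<^sub>c, x, y\<rangle>
        + [\<langle>v, y, w\<rangle>, x, z]\<^sub>c + [v, w, \<langle>z, x, y\<rangle>]\<^sub>c,
      [[v, w, x]\<^sub>c, y, z]\<^sub>c + [[v, w, z]\<^sub>c, x, y]\<^sub>c - [[x, w, y]\<^sub>c, v, z]\<^sub>c - [[z, w, y]\<^sub>c, x, v]\<^sub>c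
        + \<langle>[w, v, z]\<^sub>c, x, y\<rangle> + \<langle>[x, w, z]\<^sub>c, y, v\<rangle> + \<langle>[z, w, y]\<^sub>c, x, v\<rangle>
        + [\<langle>w, v, x\<rangle>, y, z]\<^sub>c + [\<langle>w, v, z\<rangle>, x, y]\<^sub>c - [\<langle>w, y, v\<rangle>, x, z]\<^sub>c
        - \<langle>\<langle>w, v, z\<rangle>, x, y\<rangle> + \<langle>\<langle>w, y, v\<rangle>, x, z\<rangle> + \<langle>w, x, \<langle>z, y, v\<rangle>\<rangle>})"

definition defining_identities :: "'k::field ct_poly set" where
  "defining_identities =
     comtrans_identities \<union> {commutator_identity, translator_identity} \<union> mixed_identities"


section \<open>Identities of the free associative triple system hold universally\<close>

lemma lin_ext_superset:
  assumes "vector_space scale" "finite S" "Poly_Mapping.keys f \<subseteq> S"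
  shows "lin_ext scale \<phi> f = (\<Sum>b\<in>S. scale (Poly_Mapping.lookup f b) (\<phi> b))"
proof -
  interpret vector_space scale by fact
  show ?thesis
    unfolding lin_ext_def using assms(2,3)
    by (intro sum.mono_neutral_left) (auto simp: in_keys_iff)
qed

lemma lin_ext_add:
  assumes "vector_space scale"
  shows "lin_ext scale \<phi> (f + g) = lin_ext scale \<phi> f + lin_ext scale \<phi> g"
proof -
  interpret vector_space scale by fact
  let ?S = "Poly_Mapping.keys f \<union> Poly_Mapping.keys g"
  note S = lin_ext_superset[OF assms, of ?S]
  have "Poly_Mapping.keys (f + g) \<subseteq> ?S"
    by (rule Poly_Mapping.keys_add)
  then show ?thesis
    by (simp add: S lookup_add scale_left_distrib sum.distrib)
qed

lemma lin_ext_scale: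
  assumes "vector_space scale"
  shows "lin_ext scale \<phi> (pm_scale c f) = scale c (lin_ext scale \<phi> f)"
proof -
  interpret vector_space scale by fact
  have "Poly_Mapping.keys (pm_scale c f) \<subseteq> Poly_Mapping.keys f"
    by (auto simp: in_keys_iff)
  then show ?thesis
    by (simp add: lin_ext_superset[OF assms, of "Poly_Mapping.keys f"] scale_sum_right)
qed

lemma lin_ext_single:
  assumes "vector_space scale"
  shows "lin_ext scale \<phi> (Poly_Mapping.single b c) = scale c (\<phi> b)"
proof -
  interpret vector_space scale by fact
  show ?thesis by (simp add: lin_ext_def)
qed

lemma lin_ext_add_fun:
  assumes "vector_space scale"
  shows "lin_ext scale (\<lambda>b. \<phi> b + \<psi> b) f = lin_ext scale \<phi> f + lin_ext scale \<psi> f"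
proof -
  interpret vector_space scale by fact
  show ?thesis by (simp add: lin_ext_def scale_right_distrib sum.distrib)
qed

lemma lin_ext_scale_fun:
  assumes "vector_space scale"
  shows "lin_ext scale (\<lambda>b. scale c (\<phi> b)) f = scale c (lin_ext scale \<phi> f)"
proof -
  interpret vector_space scale by fact
  show ?thesis by (simp add: lin_ext_def scale_sum_right mult.commute)
qed

lemmas pm_lin_ext = lin_ext_add[OF pm.vector_space_axioms] lin_ext_scale[OF pm.vector_space_axioms]
  lin_ext_single[OF pm.vector_space_axioms] lin_ext_add_fun[OF pm.vector_space_axioms]
  lin_ext_scale_fun[OF pm.vector_space_axioms]

lemma trilin_ext_linear:
  "trilin_ext p (f + f') g h = trilin_ext p f g h + trilin_ext p f' g h"
  "trilin_ext p f (g + g') h = trilin_ext p f g h + trilin_ext p f g' h"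
  "trilin_ext p f g (h + h') = trilin_ext p f g h + trilin_ext p f g h'"
  "trilin_ext p (pm_scale c f) g h = pm_scale c (trilin_ext p f g h)"
  "trilin_ext p f (pm_scale c g) h = pm_scale c (trilin_ext p f g h)"
  "trilin_ext p f g (pm_scale c h) = pm_scale c (trilin_ext p f g h)"
  by (simp_all add: trilin_ext_def pm_lin_ext)

lemma trilin_ext_single:
  "trilin_ext p (Poly_Mapping.single a 1) (Poly_Mapping.single b 1) (Poly_Mapping.single c 1)
     = Poly_Mapping.single (p a b c) 1"
  by (simp add: trilin_ext_def pm_lin_ext)

lemma pm_induct [case_names single add scale]:
  assumes "\<And>b. P (Poly_Mapping.single b 1)"
    and "\<And>f g. P f \<Longrightarrow> P g \<Longrightarrow> P (f + g)"
    and "\<And>c f. P f \<Longrightarrow> P (pm_scale c f)"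
  shows "P (f :: 'b \<Rightarrow>\<^sub>0 'k::field)"
proof -
  have "P 0"
    using assms(3)[OF assms(1), of 0] by simp
  moreover have "P (pm_scale c (Poly_Mapping.single b 1))" for b c
    using assms(1,3) by blast
  ultimately have "P (\<Sum>b\<in>A. pm_scale (c b) (Poly_Mapping.single b 1))" for c A
    by (induction A rule: infinite_finite_induct) (auto intro: assms(2))
  moreover have "f = (\<Sum>b\<in>Poly_Mapping.keys f. pm_scale (Poly_Mapping.lookup f b) (Poly_Mapping.single b 1))"
    by (rule poly_mapping_eqI) (simp add: lookup_sum lookup_single when_def in_keys_iff if_distrib cong: if_cong)
  ultimately show ?thesis by metis
qed

definition free_triple ::
  "('b list \<Rightarrow>\<^sub>0 'k::field) \<Rightarrow> ('b list \<Rightarrow>\<^sub>0 'k) \<Rightarrow> ('b list \<Rightarrow>\<^sub>0 'k) \<Rightarrow> ('b list \<Rightarrow>\<^sub>0 'k)" where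
  "free_triple = trilin_ext (\<lambda>a b c. a @ b @ c)"

lemma free_triple_system: "assoc_triple_system pm_scale free_triple"
proof unfold_locales
  note lin = trilin_ext_linear free_triple_def
  have both: "free_triple (free_triple v w x) y z = free_triple v (free_triple w x y) z \<and>
      free_triple v (free_triple w x y) z = free_triple v w (free_triple x y z)"
    for v w x y z :: "'b list \<Rightarrow>\<^sub>0 'k::field"
  proof (induction v rule: pm_induct)
    case v: (single v)
    show ?case
    proof (induction w rule: pm_induct)
      case w: (single w)
      show ?case
      proof (induction x rule: pm_induct)
        case x: (single x)
        show ?case
        proof (induction y rule: pm_induct)
          case y: (single y)
          show ?case
            by (induction z rule: pm_induct) (simp_all add: lin trilin_ext_single)
        qed (simp_all add: lin)
      qed (simp_all add: lin)
    qed (simp_all add: lin)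
  qed (simp_all add: lin)
  fix v w x y z :: "'b list \<Rightarrow>\<^sub>0 'k::field"
  show "free_triple (free_triple v w x) y z = free_triple v (free_triple w x y) z"
    "free_triple v (free_triple w x y) z = free_triple v w (free_triple x y z)"
    using both by blast+
qed (simp_all add: free_triple_def trilin_ext_linear)

context assoc_triple_system
begin

text \<open>Words of even length, which do not occur in the free triple system, are sent to \<open>0\<close>.\<close>
fun word_eval :: "('b \<Rightarrow> 'a) \<Rightarrow> 'b list \<Rightarrow> 'a" where
  "word_eval \<rho> [] = 0"
| "word_eval \<rho> [a] = \<rho> a"
| "word_eval \<rho> (a # b # u) = triple (\<rho> a) (\<rho> b) (word_eval \<rho> u)"

lemma triple_zero [simp]: "triple 0 y z = 0" "triple x 0 z = 0" "triple x y 0 = 0"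
  using scale_left[of 0] scale_middle[of _ 0] scale_right[of _ _ 0] by simp_all

lemma triple_sum:
  "triple (sum f A) y z = (\<Sum>a\<in>A. triple (f a) y z)"
  "triple x (sum f A) z = (\<Sum>a\<in>A. triple x (f a) z)"
  "triple x y (sum f A) = (\<Sum>a\<in>A. triple x y (f a))"
  by (induction A rule: infinite_finite_induct; simp add: add_left add_middle add_right)+

lemma word_eval_Cons_append:
  "odd (length v) \<Longrightarrow> odd (length w) \<Longrightarrow>
     word_eval \<rho> (a # v @ w) = triple (\<rho> a) (word_eval \<rho> v) (word_eval \<rho> w)"
  by (induction \<rho> v arbitrary: a rule: word_eval.induct) (simp_all add: assoc_right)

lemma word_eval_append:
  "odd (length u) \<Longrightarrow> odd (length v) \<Longrightarrow> odd (length w) \<Longrightarrow>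
     word_eval \<rho> (u @ v @ w) = triple (word_eval \<rho> u) (word_eval \<rho> v) (word_eval \<rho> w)"
  by (induction \<rho> u rule: word_eval.induct)
    (simp_all add: word_eval_Cons_append assoc_left assoc_right)

definition odd_words :: "('b list \<Rightarrow>\<^sub>0 'k) \<Rightarrow> bool" where
  "odd_words f \<longleftrightarrow> (\<forall>u\<in>Poly_Mapping.keys f. odd (length u))"

lemma free_triple_expand:
  "free_triple f g h =
    (\<Sum>u\<in>Poly_Mapping.keys f. \<Sum>v\<in>Poly_Mapping.keys g. \<Sum>w\<in>Poly_Mapping.keys h.
       pm_scale (Poly_Mapping.lookup f u * (Poly_Mapping.lookup g v * Poly_Mapping.lookup h w))
         (Poly_Mapping.single (u @ v @ w) 1))"
  unfolding free_triple_def trilin_ext_def lin_ext_def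
  by (simp add: pm.scale_sum_right)

lemma odd_words_diff: "odd_words f \<Longrightarrow> odd_words g \<Longrightarrow> odd_words (f - g)"
  using keys_diff[of f g] by (auto simp: odd_words_def)

lemma odd_words_free_triple:
  assumes "odd_words f" "odd_words g" "odd_words h"
  shows "odd_words (free_triple f g h)"
proof -
  have "\<exists>u v w. u \<in> Poly_Mapping.keys f \<and> v \<in> Poly_Mapping.keys g \<and> w \<in> Poly_Mapping.keys h
      \<and> x = u @ v @ w" if "x \<in> Poly_Mapping.keys (free_triple f g h)" for x
  proof (rule ccontr)
    assume "\<not> ?thesis"
    then have "Poly_Mapping.lookup (free_triple f g h) x = 0"
      unfolding free_triple_expand lookup_sum
      by (intro sum.neutral ballI) (auto simp: lookup_single when_def)
    then show False using that by (simp add: in_keys_iff)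
  qed
  then show ?thesis using assms by (fastforce simp: odd_words_def)
qed

lemma lin_ext_zero: "lin_ext scale \<phi> 0 = 0"
  by (simp add: lin_ext_def)

lemma lin_ext_sum: "lin_ext scale \<phi> (sum f A) = (\<Sum>a\<in>A. lin_ext scale \<phi> (f a))"
  by (induction A rule: infinite_finite_induct)
    (simp_all add: lin_ext_add[OF vector_space_axioms] lin_ext_zero)

lemma lin_ext_diff: "lin_ext scale \<phi> (f - g) = lin_ext scale \<phi> f - lin_ext scale \<phi> g"
proof -
  have "lin_ext scale \<phi> ((f - g) + g) = lin_ext scale \<phi> (f - g) + lin_ext scale \<phi> g"
    by (rule lin_ext_add[OF vector_space_axioms])
  then show ?thesis by (simp add: algebra_simps)
qed

lemma lin_ext_free_triple:
  assumes "odd_words f" "odd_words g" "odd_words h"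
  shows "lin_ext scale (word_eval \<rho>) (free_triple f g h) =
    triple (lin_ext scale (word_eval \<rho>) f) (lin_ext scale (word_eval \<rho>) g)
      (lin_ext scale (word_eval \<rho>) h)" (is "?l = ?r")
proof -
  have "?l = (\<Sum>u\<in>Poly_Mapping.keys f. \<Sum>v\<in>Poly_Mapping.keys g. \<Sum>w\<in>Poly_Mapping.keys h.
       scale (Poly_Mapping.lookup f u * (Poly_Mapping.lookup g v * Poly_Mapping.lookup h w))
         (word_eval \<rho> (u @ v @ w)))"
    unfolding free_triple_expand
    by (simp add: lin_ext_sum lin_ext_scale[OF vector_space_axioms]
        lin_ext_single[OF vector_space_axioms])
  also have "\<dots> = (\<Sum>u\<in>Poly_Mapping.keys f. \<Sum>v\<in>Poly_Mapping.keys g. \<Sum>w\<in>Poly_Mapping.keys h.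
       scale (Poly_Mapping.lookup f u * (Poly_Mapping.lookup g v * Poly_Mapping.lookup h w))
         (triple (word_eval \<rho> u) (word_eval \<rho> v) (word_eval \<rho> w)))"
    by (intro sum.cong refl)
      (use assms in \<open>simp add: odd_words_def word_eval_append\<close>)
  also have "\<dots> = ?r"
    unfolding lin_ext_def triple_sum(1) unfolding triple_sum(2) unfolding triple_sum(3)
    by (simp add: scale_left scale_middle scale_right ac_simps)
  finally show ?thesis .
qed

lemma mono_eval_free:
  "odd_words (mono_eval free_triple (\<lambda>i. Poly_Mapping.single [i] 1) t) \<and>
   lin_ext scale (word_eval \<rho>) (mono_eval free_triple (\<lambda>i. Poly_Mapping.single [i] 1) t)
     = mono_eval triple \<rho> t"
proof (induction t)
  case (Var i)
  show ?case by (simp add: odd_words_def lin_ext_single[OF vector_space_axioms])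
qed (simp_all add: special_commutator_def special_translator_def odd_words_diff
    odd_words_free_triple lin_ext_diff lin_ext_free_triple)

lemma ct_eval_free:
  "lin_ext scale (word_eval \<rho>) (ct_eval pm_scale free_triple (\<lambda>i. Poly_Mapping.single [i] 1) f)
     = ct_eval scale triple \<rho> f"
  by (simp add: ct_eval_def lin_ext_def[of pm_scale] lin_ext_sum
      lin_ext_scale[OF vector_space_axioms] mono_eval_free lin_ext_def[of scale "mono_eval triple \<rho>"])

end

theorem special_identity_universal:
  fixes f :: "'k::field ct_poly"
  assumes "special_identity TYPE(nat list \<Rightarrow>\<^sub>0 'k) f"
  shows "special_identity TYPE('a::ab_group_add) f"
  unfolding special_identity_def
proof (intro allI impI)
  fix scale :: "'k \<Rightarrow> 'a \<Rightarrow> 'a" and triple and \<rho> :: "nat \<Rightarrow> 'a"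
  assume "assoc_triple_system scale triple"
  then interpret assoc_triple_system scale triple .
  have "ct_eval pm_scale free_triple (\<lambda>i. Poly_Mapping.single [i] 1) f = 0"
    using assms free_triple_system unfolding special_identity_def by blast
  with ct_eval_free[of \<rho> f] show "ct_eval scale triple \<rho> f = 0"
    by (simp add: lin_ext_def)
qed

end

theory Submission
  imports Defs
begin

text \<open>The proof is dual. If \<open>f\<close> were not in the span of the consequences, some linear functional
\<open>\<phi>\<close> would vanish on all consequences and not on \<open>f\<close>; it is shown that a functional vanishing on
the consequences vanishes on every identity of degree five.

The comtrans identities say precisely that the two operations have the form \<open>xyz - yxz\<close> and
\<open>xyz - yzx\<close> for a single ternary operation (\<open>comtrans_pair.C_word\<close>, \<open>comtrans_pair.T_word\<close>).
Applied to the outer and to the inner operation of a monomial of degree five, this describes \<open>\<phi>\<close>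
by three functions \<open>L\<close>, \<open>M\<close>, \<open>R\<close> of five letters: the values at \<open>(abc)de\<close>, \<open>a(bcd)e\<close> and
\<open>ab(cde)\<close>. Every monomial is a difference of differences of such values. In an associative triple
system the brackets disappear, so what has to be found is one function \<open>h\<close> of words without
brackets that has the same double differences: then \<open>\<phi>\<close> factors through the expansion of
monomials into words, and an element whose expansion is zero is killed by \<open>\<phi>\<close>.

The words in five letters are the vertices of the permutohedron, and its edges exchange two
neighbouring letters. The double differences do not give the difference of \<open>h\<close> along an edge
that exchanges \<open>a\<close> and \<open>b\<close>, but they compare these differences for two edges as long as \<open>a\<close>
and \<open>b\<close> have the same third letter \<open>c\<close> next to them, on the same side: the block \<open>abc\<close> (or
\<open>cab\<close>) is then moved as a whole. There are six such blocks for each pair, and neighbouring blocks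
overlap. The commutator, translator and mixed identities are what is needed to glue: two blocks
agree where they overlap (\<open>overlap_0\<close>), running once around the six blocks gives no contradiction
(\<open>gap_cycle_0\<close>), and the form on the edges obtained in this way is closed on the squares and
hexagons of the permutohedron (\<open>edge_closed\<close>). Closed forms are exact
(\<open>closed_edge_form.exact\<close>), which gives \<open>h\<close>.\<close>

section \<open>Closed forms on the edges of a permutohedron\<close>

text \<open>The value of \<open>\<theta> u a b v\<close> belongs to the edge from the word \<open>u @ [a, b] @ v\<close> to
\<open>u @ [b, a] @ v\<close>. The axioms say that the sum over the boundary vanishes for the two-dimensional
faces of the permutohedron: squares come from two disjoint exchanges, hexagons from the six
arrangements of three consecutive letters.\<close>

locale closed_edge_form =
  fixes A :: "'a set"
    and \<theta> :: "'a list \<Rightarrow> 'a \<Rightarrow> 'a \<Rightarrow> 'a list \<Rightarrow> 'k::field"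
  assumes antisym: "distinct (u @ [a, b] @ v) \<Longrightarrow> set (u @ [a, b] @ v) = A \<Longrightarrow> \<theta> u b a v = - \<theta> u a b v"
    and square: "distinct (u @ [a, b] @ v @ [c, d] @ w) \<Longrightarrow> set (u @ [a, b] @ v @ [c, d] @ w) = A \<Longrightarrow>
      \<theta> u a b (v @ [c, d] @ w) - \<theta> u a b (v @ [d, c] @ w)
        = \<theta> (u @ [a, b] @ v) c d w - \<theta> (u @ [b, a] @ v) c d w"
    and hexagon: "distinct (u @ [a, b, c] @ v) \<Longrightarrow> set (u @ [a, b, c] @ v) = A \<Longrightarrow>
      \<theta> u a b (c # v) + \<theta> (u @ [b]) a c v + \<theta> u b c (a # v)
        = \<theta> (u @ [a]) b c v + \<theta> u a c (b # v) + \<theta> (u @ [c]) a b v"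
begin

text \<open>The sum of \<open>\<theta>\<close> along the path that moves \<open>z\<close> in \<open>u @ z # v @ s\<close> to the right, until it stands
  directly before \<open>s\<close>.\<close>

primrec carry :: "'a \<Rightarrow> 'a list \<Rightarrow> 'a list \<Rightarrow> 'a list \<Rightarrow> 'k" where
  "carry z [] u s = 0"
| "carry z (x # v) u s = \<theta> u z x (v @ s) + carry z v (u @ [x]) s"

text \<open>Exchanging two letters that the moving letter never passes shifts the whole path across a strip of
squares.\<close>

lemma carry_swap_before:
  assumes "distinct (u @ [a, b] @ v @ [z] @ w @ s)" "set (u @ [a, b] @ v @ [z] @ w @ s) = A"
  shows "carry z w (u @ [a, b] @ v) s - carry z w (u @ [b, a] @ v) s
    = \<theta> u a b (v @ [z] @ w @ s) - \<theta> u a b (v @ w @ [z] @ s)"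
  using assms
proof (induction w arbitrary: v)
  case (Cons x w)
  have IH: "carry z w (u @ [a, b] @ (v @ [x])) s - carry z w (u @ [b, a] @ (v @ [x])) s
    = \<theta> u a b ((v @ [x]) @ [z] @ w @ s) - \<theta> u a b ((v @ [x]) @ w @ [z] @ s)"
    using Cons.prems by (intro Cons.IH) auto
  have "\<theta> u a b (v @ [z, x] @ (w @ s)) - \<theta> u a b (v @ [x, z] @ (w @ s))
      = \<theta> (u @ [a, b] @ v) z x (w @ s) - \<theta> (u @ [b, a] @ v) z x (w @ s)"
    using Cons.prems by (intro square) auto
  with IH show ?case
    unfolding append_assoc append.simps append_Nil2 carry.simps by algebra
qed simp

text \<open>If the moving letter does pass the two exchanged letters, one hexagon joins the squares; this is
the step \<open>v = []\<close>.\<close>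

lemma carry_swap_after:
  assumes "distinct (u @ [z] @ v @ [a, b] @ w @ s)" "set (u @ [z] @ v @ [a, b] @ w @ s) = A"
  shows "carry z (v @ [a, b] @ w) u s - carry z (v @ [b, a] @ w) u s
    = \<theta> (u @ [z] @ v) a b (w @ s) - \<theta> (u @ v) a b (w @ [z] @ s)"
  using assms
proof (induction v arbitrary: u)
  case Nil
  have "carry z w (u @ [a, b] @ []) s - carry z w (u @ [b, a] @ []) s
    = \<theta> u a b ([] @ [z] @ w @ s) - \<theta> u a b ([] @ w @ [z] @ s)"
    using Nil by (intro carry_swap_before) auto
  moreover have "\<theta> u z a (b # w @ s) + \<theta> (u @ [a]) z b (w @ s) + \<theta> u a b (z # w @ s)
      = \<theta> (u @ [z]) a b (w @ s) + \<theta> u z b (a # w @ s) + \<theta> (u @ [b]) z a (w @ s)"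
    using Nil by (intro hexagon) auto
  ultimately show ?case
    unfolding append_assoc append.simps append_Nil2 carry.simps by algebra
next
  case (Cons x v)
  have IH: "carry z (v @ [a, b] @ w) (u @ [x]) s - carry z (v @ [b, a] @ w) (u @ [x]) s
    = \<theta> ((u @ [x]) @ [z] @ v) a b (w @ s) - \<theta> ((u @ [x]) @ v) a b (w @ [z] @ s)"
    using Cons.prems by (intro Cons.IH) auto
  have "\<theta> u z x (v @ [a, b] @ (w @ s)) - \<theta> u z x (v @ [b, a] @ (w @ s))
      = \<theta> (u @ [z, x] @ v) a b (w @ s) - \<theta> (u @ [x, z] @ v) a b (w @ s)"
    using Cons.prems by (intro square) auto
  with IH show ?case
    unfolding append_assoc append.simps append_Nil2 carry.simps by algebra
qed

text \<open>The potential is built by removing one letter \<open>z\<close> after the other: \<open>z\<close> is moved to the end, at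
the cost \<open>carry\<close>, and the remaining letters are arranged with \<open>z\<close> added to the fixed suffix.
Exchanges with \<open>z\<close> are correct by construction, and the others by the two lemmas above.\<close>

lemma exact_with_suffix:
  assumes "distinct (zs @ s)" "set (zs @ s) = A"
  shows "\<exists>h. \<forall>u a b v. distinct (u @ [a, b] @ v) \<longrightarrow> set (u @ [a, b] @ v) = set zs \<longrightarrow>
    h (u @ [a, b] @ v) - h (u @ [b, a] @ v) = \<theta> u a b (v @ s)"
  using assms
proof (induction zs arbitrary: s)
  case (Cons z zs)
  obtain h where h: "\<And>u a b v. distinct (u @ [a, b] @ v) \<Longrightarrow> set (u @ [a, b] @ v) = set zs \<Longrightarrow>
      h (u @ [a, b] @ v) - h (u @ [b, a] @ v) = \<theta> u a b (v @ z # s)"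
    using Cons.IH[of "z # s"] Cons.prems by auto
  define H where
    "H w = carry z (tl (dropWhile (\<lambda>x. x \<noteq> z) w)) (takeWhile (\<lambda>x. x \<noteq> z) w) s + h (remove1 z w)" for w
  have H: "H (u @ z # v) = carry z v u s + h (u @ v)" if "z \<notin> set u" for u v
  proof -
    have "takeWhile (\<lambda>x. x \<noteq> z) (u @ z # v) = u" "dropWhile (\<lambda>x. x \<noteq> z) (u @ z # v) = z # v"
      using that by (auto simp: takeWhile_append dropWhile_append)
    then show ?thesis using that by (simp add: H_def remove1_append)
  qed
  have "H (u @ [a, b] @ v) - H (u @ [b, a] @ v) = \<theta> u a b (v @ s)"
    if dist: "distinct (u @ [a, b] @ v)" and set: "set (u @ [a, b] @ v) = set (z # zs)" for u a b v
  proof -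
    have word: "distinct (u @ [a, b] @ v @ s)" "set (u @ [a, b] @ v @ s) = A"
      using dist set Cons.prems by auto
    have "z \<in> set (u @ [a, b] @ v)" using set by auto
    then consider "a = z" | "b = z" | "z \<in> set u" | "z \<in> set v" by auto
    then show ?thesis
    proof cases
      assume "a = z"
      then show ?thesis using H[of u "b # v"] H[of "u @ [b]" v] dist by simp
    next
      assume "b = z"
      then show ?thesis
        using H[of u "a # v"] H[of "u @ [a]" v] dist antisym[of u a b "v @ s"] word by auto
    next
      assume "z \<in> set u"
      then obtain u1 u2 where u: "u = u1 @ z # u2" by (auto dest: split_list)
      have "h ((u1 @ u2) @ [a, b] @ v) - h ((u1 @ u2) @ [b, a] @ v) = \<theta> (u1 @ u2) a b (v @ z # s)"
        using dist set Cons.prems by (intro h) (auto simp: u)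
      moreover have "carry z (u2 @ [a, b] @ v) u1 s - carry z (u2 @ [b, a] @ v) u1 s
          = \<theta> (u1 @ [z] @ u2) a b (v @ s) - \<theta> (u1 @ u2) a b (v @ [z] @ s)"
        using word by (intro carry_swap_after) (auto simp: u)
      ultimately show ?thesis
        using H[of u1 "u2 @ [a, b] @ v"] H[of u1 "u2 @ [b, a] @ v"] dist
        by (auto simp: u algebra_simps)
    next
      assume "z \<in> set v"
      then obtain v1 v2 where v: "v = v1 @ z # v2" by (auto dest: split_list)
      have "h (u @ [a, b] @ (v1 @ v2)) - h (u @ [b, a] @ (v1 @ v2)) = \<theta> u a b ((v1 @ v2) @ z # s)"
        using dist set Cons.prems by (intro h) (auto simp: v)
      moreover have "carry z v2 (u @ [a, b] @ v1) s - carry z v2 (u @ [b, a] @ v1) s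
          = \<theta> u a b (v1 @ [z] @ v2 @ s) - \<theta> u a b (v1 @ v2 @ [z] @ s)"
        using word by (intro carry_swap_before) (auto simp: v)
      ultimately show ?thesis
        using H[of "u @ [a, b] @ v1" v2] H[of "u @ [b, a] @ v1" v2] dist
        by (auto simp: v algebra_simps)
    qed
  qed
  then show ?case by blast
qed simp

theorem exact:
  assumes "finite A"
  shows "\<exists>h. \<forall>u a b v. distinct (u @ [a, b] @ v) \<longrightarrow> set (u @ [a, b] @ v) = A \<longrightarrow>
    h (u @ [a, b] @ v) - h (u @ [b, a] @ v) = \<theta> u a b v"
proof -
  obtain zs where "distinct zs" "set zs = A"
    using finite_distinct_list[OF assms] by blast
  then show ?thesis using exact_with_suffix[of zs "[]"] by simp
qed

end

section \<open>The identities as relations between bracketed words\<close>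

text \<open>The functions \<open>L\<close>, \<open>M\<close> and \<open>R\<close> give values to the bracketed words \<open>(abc)de\<close>, \<open>a(bcd)e\<close> and
\<open>ab(cde)\<close>; their arguments are always in reading order.\<close>

locale bracketed_words =
  fixes L M R :: "'a \<Rightarrow> 'a \<Rightarrow> 'a \<Rightarrow> 'a \<Rightarrow> 'a \<Rightarrow> 'k::field_char_0"
begin

text \<open>These are the values after the inner product has been replaced by a commutator or a translator. The
monomial \<open>[[a, b, c], d, e]\<close> then has the value \<open>cL a b c d e - cM d a b c e\<close>, and similarly for
the other monomials; in this way the identities of degree five become the following expressions.\<close>

definition "cL a b c d e = L a b c d e - L b a c d e"
definition "cM d a b c e = M d a b c e - M d b a c e"
definition "cR d e a b c = R d e a b c - R d e b a c"
definition "tL a b c d e = L a b c d e - L b c a d e"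
definition "tM d a b c e = M d a b c e - M d b c a e"
definition "tR d e a b c = R d e a b c - R d e b c a"

definition "com_T v w x y z = (cL v w x y z - cM y v w x z) - (cR v w x y z - cR w v x y z)"

definition "com_id v w x y z = com_T v w x y z + com_T w y x v z + com_T y v x w z"

definition "tra_id v w x y z =
  (tL v w x y z - tR y z v w x) - (tL v y z w x - tR w x v y z)
   - (tM v w y z x - tL w y z x v) - (tR v w x y z - tM w x y z v)"

definition "mixed1 v w x y z =
  (cL v w x y z - cM y v w x z) + (cL x v y w z - cM w x v y z) - (tL v w x y z - tM y v w x z)
   + (tL v y w x z - tM x v y w z) - (tL x y w v z - tM v x y w z)"

definition "mixed2 v w x y z =
  (cL v w x y z - cM y v w x z) - (cL v y w x z - cM x v y w z) + (cL w v z x y - cR x y w v z)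
   + (tL v y w x z - tM x v y w z) + (tR v w z x y - tR w v z x y)"

definition "mixed3 v w x y z =
  (cL v w x y z - cM y v w x z) + (cL v w z x y - cM x v w z y) - (cL x w y v z - cM v x w y z)
  - (cL z w y x v - cM x z w y v) + (cL w v z x y - cR x y w v z) + (cL x w z y v - cR y v x w z)
  + (cL z w y x v - cR x v z w y) + (tL w v x y z - tM y w v x z) + (tL w v z x y - tM x w v z y)
  - (tL w y v x z - tM x w y v z) - (tL w v z x y - tR x y w v z) + (tL w y v x z - tR x z w y v)
  + (tR w x z y v - tM x z y v w)"

lemmas identity_defs = com_id_def com_T_def tra_id_def mixed1_def mixed2_def mixed3_def
  cL_def cM_def cR_def tL_def tM_def tR_def

text \<open>For a pair \<open>a\<close>, \<open>b\<close>, the block \<open>abc\<close> and the block \<open>dab\<close> have two words in common, \<open>dabce\<close> and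
\<open>edabc\<close>. The gap compares the values that the two blocks give to the exchange of \<open>a\<close> and \<open>b\<close> in
\<open>dabce\<close>, and \<open>overlap\<close> is the difference to the same comparison in \<open>edabc\<close>.\<close>

definition "gap a b c d e = L d a b c e - L d b a c e - (M d a b c e - M d b a c e)"

definition "overlap a b c d e =
  M e d a b c - M e d b a c - (R e d a b c - R e d b a c) - gap a b c d e"

text \<open>The square in which the disjoint pairs \<open>ab\<close> and \<open>cd\<close> are exchanged at the two ends of a word,
where a single block is enough for either pair.\<close>

definition "end_square a b c d e = L a b e c d - L b a e c d - (L a b e d c - L b a e d c)
  - (R a b e c d - R a b e d c) + (R b a e c d - R b a e d c)"

text \<open>The proof that \<open>overlap\<close> vanishes uses all five identities, but these three combinations of its
values are more accessible. If the first and the third vanish, then \<open>overlap\<close> is alternating in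
\<open>a\<close>, \<open>b\<close>, \<open>c\<close>, \<open>d\<close>, so that the three terms of the second one are equal and their sum is
\<open>3 * overlap a b c d e\<close>.\<close>

definition "skew_overlap a b c d e = overlap a b c d e + overlap a b d c e"

definition "triangle a b c d e = overlap a b c d e - overlap a d c b e + overlap b d c a e"

definition "reflected_overlap a b c d e = overlap a b c d e + overlap c b a d e"

text \<open>The gaps on the way from the block \<open>abc\<close> over \<open>dab\<close> and \<open>abe\<close> to the block \<open>cab\<close>. In the boundary of
the hexagon on \<open>a\<close>, \<open>b\<close>, \<open>c\<close> the values within the blocks cancel, and the turns remain.\<close>

definition "turn a b c d e = gap a b c d e - gap a b e d c + gap a b e c d"

lemmas relation_defs = end_square_def skew_overlap_def triangle_def reflected_overlap_def
  turn_def overlap_def gap_def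

text \<open>The following equations are formal: they hold for arbitrary \<open>L\<close>, \<open>M\<close> and \<open>R\<close>, because both sides
have the same expansion. The combinations are solutions of the linear systems over the values of
the identities at permuted letters; the order of the lemmas is chosen to keep them short.\<close>

lemma skew_overlap: "skew_overlap a b c d e = mixed3 d b e c a + mixed1 b d e c a - mixed2 a b c d e
   + tra_id b e a c d + tra_id e c d b a - tra_id e c d a b"
  unfolding relation_defs identity_defs by algebra

lemma end_square: "2 * end_square a b c d e =
    mixed1 b a d c e - mixed1 a d b c e - mixed1 a b d c e - 2 * mixed2 a b c d e + 2 * mixed2 a b d c e
    + com_id a b c d e - com_id a b d c e + com_id a c b d e - com_id b c a d e"
  unfolding relation_defs identity_defs by algebra

lemma triangle: "triangle a b c d e = end_square a d c e b - end_square a b c e d + end_square b d a e c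
    - end_square b d c e a - mixed1 b a d e c - mixed2 b d e a c + mixed2 a d b e c - mixed2 a b d e c
    - com_id b d a e c - com_id a b c d e"
  unfolding relation_defs identity_defs by algebra

lemma reflected_overlap: "2 * reflected_overlap a b c d e =
    triangle a b c d e - triangle b c a d e - skew_overlap b d a c e
    + tra_id e b a d c + tra_id e d a b c + tra_id e b c d a + tra_id e d c b a"
  unfolding relation_defs identity_defs by algebra

lemma overlap: "3 * overlap a b c d e = reflected_overlap a b c d e - reflected_overlap b a c d e
    + skew_overlap a b c d e - skew_overlap a c b d e + skew_overlap b c a d e - triangle a b d c e"
  unfolding relation_defs by algebra

lemma gap_cycle: "gap a b c d e - gap a b e d c + gap a b e c d - gap a b d c e + gap a b d e c - gap a b c e d
    = overlap a b c e d + overlap a b d c e + overlap a b e d c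
      + mixed2 a b c d e + mixed2 a b d e c + mixed2 a b e c d"
  unfolding relation_defs identity_defs by algebra

text \<open>The left hand sides are the boundaries of the remaining kinds of squares and, in \<open>turn\<close>, twice the
boundary of a hexagon. They contain gaps where an exchange has to be compared in two different
blocks.\<close>

lemma start_square: "L a b c d e - L b a c d e - (L a b d c e - L b a d c e)
    + gap a b c e d - gap a b d e c - (R a b c d e - R a b d c e) + (R b a c d e - R b a d c e)
    = - end_square a b c e d - overlap a b c e d - mixed2 a b d e c"
  unfolding relation_defs identity_defs by algebra

lemma inner_square: "L e a b c d - L e b a c d - (L e a b d c - L e b a d c)
    - (R e a b c d - R e a b d c) + (R e b a c d - R e b a d c) - gap c d e a b + gap c d e b a
    = mixed1 a b c e d - end_square a e c d b - overlap c d e b a - tra_id c a d e b - mixed3 b c a e d"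
  unfolding relation_defs identity_defs by algebra

lemma turn: "2 * (turn a b c d e - turn a c b d e + turn b c a d e)
    = mixed1 a d c b e - mixed1 b d c a e - mixed1 a d b c e - com_id a b c d e - com_id a b d c e
      + com_id a c b d e - com_id b c a d e
      + 2 * (overlap a b e d c + overlap b c e d a - overlap a c e d b - triangle a b e c d)"
  unfolding relation_defs identity_defs by algebra

end

section \<open>The potential of a functional\<close>

text \<open>The reversed list supplies the simplifier with all inequalities in the other orientation.\<close>

lemma distinct_both_ways:
  "distinct [a, b, c, d, e] \<Longrightarrow> distinct [a, b, c, d, e] \<and> distinct [e, d, c, b, a]"
  by auto

text \<open>The identities are imposed on distinct letters only, because consequences are multilinear.\<close>

locale comtrans_words = bracketed_words L M R
  for L M R :: "'a \<Rightarrow> 'a \<Rightarrow> 'a \<Rightarrow> 'a \<Rightarrow> 'a \<Rightarrow> 'k::field_char_0" +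
  assumes com_id: "distinct [v, w, x, y, z] \<Longrightarrow> com_id v w x y z = 0"
    and tra_id: "distinct [v, w, x, y, z] \<Longrightarrow> tra_id v w x y z = 0"
    and mixed1: "distinct [v, w, x, y, z] \<Longrightarrow> mixed1 v w x y z = 0"
    and mixed2: "distinct [v, w, x, y, z] \<Longrightarrow> mixed2 v w x y z = 0"
    and mixed3: "distinct [v, w, x, y, z] \<Longrightarrow> mixed3 v w x y z = 0"
begin

lemmas identities = com_id tra_id mixed1 mixed2 mixed3

lemma end_square_0: assumes "distinct [a, b, c, d, e]" shows "end_square a b c d e = 0"
proof -
  have "2 * end_square a b c d e = 0"
    using distinct_both_ways[OF assms] unfolding end_square by (simp add: identities)
  then show ?thesis by (metis mult_eq_0_iff zero_neq_numeral)
qed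

lemma skew_overlap_0: assumes "distinct [a, b, c, d, e]" shows "skew_overlap a b c d e = 0"
  using distinct_both_ways[OF assms] unfolding skew_overlap by (simp add: identities)

lemma triangle_0: assumes "distinct [a, b, c, d, e]" shows "triangle a b c d e = 0"
  using distinct_both_ways[OF assms] unfolding triangle by (simp add: identities end_square_0)

lemma reflected_overlap_0:
  assumes "distinct [a, b, c, d, e]" shows "reflected_overlap a b c d e = 0"
proof -
  have "2 * reflected_overlap a b c d e = 0"
    using distinct_both_ways[OF assms] unfolding reflected_overlap by (simp add: identities triangle_0 skew_overlap_0)
  then show ?thesis by (metis mult_eq_0_iff zero_neq_numeral)
qed

lemma overlap_0: assumes "distinct [a, b, c, d, e]" shows "overlap a b c d e = 0"
proof -
  have "3 * overlap a b c d e = 0"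
    using distinct_both_ways[OF assms] unfolding overlap by (simp add: reflected_overlap_0 triangle_0 skew_overlap_0)
  then show ?thesis by (metis mult_eq_0_iff zero_neq_numeral)
qed

lemma gap_cycle_0:
  assumes "distinct [a, b, c, d, e]"
  shows "gap a b c d e - gap a b e d c + gap a b e c d - gap a b d c e + gap a b d e c - gap a b c e d = 0"
  using distinct_both_ways[OF assms] unfolding gap_cycle by (simp add: identities overlap_0)

lemma turn_0:
  assumes "distinct [a, b, c, d, e]"
  shows "turn a b c d e - turn a c b d e + turn b c a d e = 0"
proof -
  have "2 * (turn a b c d e - turn a c b d e + turn b c a d e) = 0"
    using distinct_both_ways[OF assms] unfolding turn by (simp add: identities overlap_0 triangle_0)
  then show ?thesis by (metis mult_eq_0_iff zero_neq_numeral)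
qed

text \<open>Within a block the values are correct up to a constant. The constants \<open>after a b c\<close> of the block
\<open>abc\<close> and \<open>before a b d\<close> of the block \<open>dab\<close> must differ by the gap of the two blocks; this has a
solution by \<open>gap_cycle_0\<close>, and it is unique if the constants \<open>after a b c\<close> have the sum zero over
the three letters \<open>c\<close>. That choice keeps the formulas free from any order of the letters. The
arguments \<open>d\<close>, \<open>e\<close> of \<open>after\<close> and \<open>c\<close>, \<open>e\<close> of \<open>before\<close> are the letters outside the block,
whose order is immaterial.\<close>

definition "after a b c d e = (gap a b c e d - gap a b d e c + gap a b c d e - gap a b e d c) / 3"
definition "before a b d c e = after a b c d e - gap a b c d e"

lemma after_commute: "after a b c e d = after a b c d e"
  by (simp add: after_def)

lemma gap_antisym: "gap b a c d e = - gap a b c d e"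
  by (simp add: gap_def)

lemma after_antisym: "after b a c d e = - after a b c d e"
  unfolding after_def gap_antisym[of b a] minus_divide_left by simp

lemma before_antisym: "before b a d c e = - before a b d c e"
  by (simp add: before_def after_antisym[of b a] gap_antisym[of b a])

lemma after_diff:
  assumes "distinct [a, b, c, d, e]"
  shows "after a b c d e - after a b d c e = gap a b c e d - gap a b d e c"
proof -
  have "3 * after a b c d e = gap a b c e d - gap a b d e c + gap a b c d e - gap a b e d c"
    and "3 * after a b d c e = gap a b d e c - gap a b c e d + gap a b d c e - gap a b e c d"
    by (simp_all add: after_def)
  then have "3 * (after a b c d e - after a b d c e - (gap a b c e d - gap a b d e c)) = 0"
    using gap_cycle_0[OF assms] by algebra
  then have "after a b c d e - after a b d c e - (gap a b c e d - gap a b d e c) = 0"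
    by (metis mult_eq_0_iff zero_neq_numeral)
  then show ?thesis by simp
qed

lemma before_commute:
  assumes "distinct [a, b, c, d, e]"
  shows "before a b d e c = before a b d c e"
proof -
  have "after a b c e d - after a b e c d = gap a b c d e - gap a b e d c"
    using assms by (intro after_diff) auto
  then show ?thesis
    unfolding before_def using after_commute[of a b c e d] after_commute[of a b e c d] by algebra
qed

lemma offset_turn:
  assumes "distinct [a, b, c, d, e]"
  shows "after a b c d e - before a b c d e = turn a b c d e"
proof -
  have "after a b c e d - after a b e c d = gap a b c d e - gap a b e d c"
    using assms by (intro after_diff) auto
  moreover have "before a b c d e = before a b c e d"
    using assms by (intro before_commute) auto
  ultimately show ?thesis
    unfolding before_def turn_def using after_commute[of a b c e d] after_commute[of a b e c d] by algebra
qed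

text \<open>If \<open>a\<close> and \<open>b\<close> stand in the middle of the word, there are two blocks to choose from; \<open>edge1\<close> and
\<open>edge2\<close> show that the choice does not matter.\<close>

fun edge :: "'a list \<Rightarrow> 'a \<Rightarrow> 'a \<Rightarrow> 'a list \<Rightarrow> 'k" where
  "edge [] a b [c, d, e] = L a b c d e - L b a c d e + after a b c d e"
| "edge [c] a b [d, e] = M c a b d e - M c b a d e + after a b d c e"
| "edge [c, d] a b [e] = M c d a b e - M c d b a e + before a b d c e"
| "edge [c, d, e] a b [] = R c d e a b - R c d e b a + before a b e c d"
| "edge _ _ _ _ = 0"

lemma edge1: "edge [c] a b [d, e] = L c a b d e - L c b a d e + before a b c d e"
  by (simp add: before_def gap_def)

lemma edge2:
  assumes "distinct [a, b, c, d, e]"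
  shows "edge [c, d] a b [e] = R c d a b e - R c d b a e + after a b e c d"
proof -
  have "overlap a b e d c = 0" "before a b d e c = before a b d c e"
    using assms by (auto intro!: overlap_0 before_commute)
  then show ?thesis
    unfolding edge.simps overlap_def before_def[of a b d e c] using after_commute[of a b e c d] by algebra
qed

text \<open>In each of the squares and hexagons the blocks can be chosen such that most constants cancel; the
others combine to gaps.\<close>

lemma edge_start_square:
  assumes "distinct [a, b, c, d, e]"
  shows "edge [] a b [c, d, e] - edge [] a b [d, c, e] = edge [a, b] c d [e] - edge [b, a] c d [e]"
proof -
  have "edge [a, b] c d [e] = R a b c d e - R a b d c e + after c d e a b"
    "edge [b, a] c d [e] = R b a c d e - R b a d c e + after c d e b a"
    using assms by (auto intro!: edge2 simp del: edge.simps)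
  moreover have "L a b c d e - L b a c d e - (L a b d c e - L b a d c e)
    + gap a b c e d - gap a b d e c - (R a b c d e - R a b d c e) + (R b a c d e - R b a d c e) = 0"
    using distinct_both_ways[OF assms] unfolding start_square
    by (simp add: identities overlap_0 end_square_0)
  ultimately show ?thesis
    using after_diff[OF assms] after_commute[of c d e b a] unfolding edge.simps(1) by algebra
qed

lemma edge_end_square:
  assumes "distinct [a, b, c, d, e]"
  shows "edge [] a b [e, c, d] - edge [] a b [e, d, c] = edge [a, b, e] c d [] - edge [b, a, e] c d []"
proof -
  have Q: "before c d e a b = before c d e b a"
    using assms by (intro before_commute) auto
  show ?thesis
    using end_square_0[OF assms]
    unfolding end_square_def edge.simps after_commute[of a b e c d] Q by algebra
qed

lemma edge_inner_square:
  assumes "distinct [a, b, c, d, e]"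
  shows "edge [e] a b [c, d] - edge [e] a b [d, c] = edge [e, a, b] c d [] - edge [e, b, a] c d []"
proof -
  have "L e a b c d - L e b a c d - (L e a b d c - L e b a d c)
    - (R e a b c d - R e a b d c) + (R e b a c d - R e b a d c) - gap c d e a b + gap c d e b a = 0"
    using distinct_both_ways[OF assms] unfolding inner_square
    by (simp add: identities overlap_0 end_square_0)
  moreover have "before a b e d c = before a b e c d" "before c d b a e = before c d b e a" "before c d a b e = before c d a e b"
    using assms by (auto intro!: before_commute)
  moreover have "before c d b e a = after c d e b a - gap c d e b a" "before c d a e b = after c d e a b - gap c d e a b"
    by (simp_all add: before_def)
  ultimately show ?thesis
    using after_commute[of c d e b a] unfolding edge1 edge.simps by algebra
qed

lemma offset_hexagon:
  assumes "distinct [a, b, c, d, e]"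
  shows "after a b c d e + before a c b d e + after b c a d e = before b c a d e + after a c b d e + before a b c d e"
proof -
  have "after a b c d e - before a b c d e = turn a b c d e" "after a c b d e - before a c b d e = turn a c b d e"
    "after b c a d e - before b c a d e = turn b c a d e"
    using assms by (auto intro!: offset_turn)
  with turn_0[OF assms] show ?thesis by algebra
qed

lemma edge_hexagon:
  assumes "distinct (u @ [a, b, c] @ v)" "length (u @ v) = 2"
  shows "edge u a b (c # v) + edge (u @ [b]) a c v + edge u b c (a # v)
        = edge (u @ [a]) b c v + edge u a c (b # v) + edge (u @ [c]) a b v"
proof -
  consider d e where "u = []" "v = [d, e]" | d e where "u = [d]" "v = [e]"
    | d e where "u = [d, e]" "v = []"
    using assms(2) by (cases u; cases v; cases "tl u"; cases "tl v") auto
  then show ?thesis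
  proof cases
    case (1 d e)
    then have d: "distinct [a, b, c, d, e]" using assms(1) by auto
    show ?thesis
      using offset_hexagon[OF d] unfolding 1 append.simps edge1 edge.simps by algebra
  next
    case (2 d e)
    then have d: "distinct [a, b, c, d, e]" using assms(1) by auto
    show ?thesis
      using offset_hexagon[OF d] unfolding 2 append.simps edge.simps by algebra
  next
    case (3 d e)
    then have d: "distinct [a, b, c, d, e]" using assms(1) by auto
    have "edge [d, e] a b [c] = R d e a b c - R d e b a c + after a b c d e"
      "edge [d, e] b c [a] = R d e b c a - R d e c b a + after b c a d e"
      "edge [d, e] a c [b] = R d e a c b - R d e c a b + after a c b d e"
      using d by (auto intro!: edge2 simp del: edge.simps)
    with offset_hexagon[OF d] show ?thesis
      unfolding 3 append.simps edge.simps(4) by algebra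
  qed
qed

lemma edge_antisym: "edge u b a v = - edge u a b v"
  by (cases "(u, a, b, v)" rule: edge.cases) (simp_all add: after_antisym[of b a] before_antisym[of b a])

lemma edge_closed:
  assumes "card A = 5"
  shows "closed_edge_form A edge"
proof
  fix u a b v
  show "edge u b a v = - edge u a b v" by (rule edge_antisym)
next
  fix u a b v c d w
  assume dist: "distinct (u @ [a, b] @ v @ [c, d] @ w)" and "set (u @ [a, b] @ v @ [c, d] @ w) = A"
  then have "length (u @ v @ w) = 1"
    using assms distinct_card[OF dist] by auto
  then consider e where "u = [e]" "v = []" "w = []" | e where "u = []" "v = [e]" "w = []"
    | e where "u = []" "v = []" "w = [e]"
    by (cases u; cases v; cases w) auto
  then show "edge u a b (v @ [c, d] @ w) - edge u a b (v @ [d, c] @ w)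
      = edge (u @ [a, b] @ v) c d w - edge (u @ [b, a] @ v) c d w"
  proof cases
    case (1 e)
    then have "distinct [a, b, c, d, e]" using dist by auto
    from edge_inner_square[OF this] show ?thesis unfolding 1 by simp
  next
    case (2 e)
    then have "distinct [a, b, c, d, e]" using dist by auto
    from edge_end_square[OF this] show ?thesis unfolding 2 by simp
  next
    case (3 e)
    then have "distinct [a, b, c, d, e]" using dist by auto
    from edge_start_square[OF this] show ?thesis unfolding 3 by simp
  qed
next
  fix u a b c v
  assume dist: "distinct (u @ [a, b, c] @ v)" and "set (u @ [a, b, c] @ v) = A"
  then have "length (u @ v) = 2"
    using assms distinct_card[OF dist] by auto
  with dist show "edge u a b (c # v) + edge (u @ [b]) a c v + edge u b c (a # v)
      = edge (u @ [a]) b c v + edge u a c (b # v) + edge (u @ [c]) a b v"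
    by (rule edge_hexagon)
qed

text \<open>The error terms \<open>S\<close> and \<open>S'\<close> depend on the inner product alone, not on its position in the word.
They cancel in every monomial, since the outer operation is again a difference.\<close>

theorem potential:
  assumes "card A = 5"
  shows "\<exists>h S S'. \<forall>a b c d e. distinct [a, b, c, d, e] \<longrightarrow> {a, b, c, d, e} = A \<longrightarrow>
    S a b c e d = S a b c d e \<and> S' a b c e d = S' a b c d e \<and>
    cL a b c d e = h [a, b, c, d, e] - h [b, a, c, d, e] + S a b c d e \<and>
    cM d a b c e = h [d, a, b, c, e] - h [d, b, a, c, e] + S a b c d e \<and>
    cR d e a b c = h [d, e, a, b, c] - h [d, e, b, a, c] + S a b c d e \<and>
    tL a b c d e = h [a, b, c, d, e] - h [b, c, a, d, e] + S' a b c d e \<and>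
    tM d a b c e = h [d, a, b, c, e] - h [d, b, c, a, e] + S' a b c d e \<and>
    tR d e a b c = h [d, e, a, b, c] - h [d, e, b, c, a] + S' a b c d e"
proof -
  have "finite A" using assms card.infinite by force
  then obtain h where h: "\<And>u a b v. distinct (u @ [a, b] @ v) \<Longrightarrow> set (u @ [a, b] @ v) = A \<Longrightarrow>
      h (u @ [a, b] @ v) - h (u @ [b, a] @ v) = edge u a b v"
    using closed_edge_form.exact[OF edge_closed[OF assms]] by blast
  show ?thesis
  proof (rule exI[of _ h], rule exI[of _ "\<lambda>a b c d e. - after a b c d e"],
      rule exI[of _ "\<lambda>a b c d e. - after a b c d e - before a c b d e"], intro allI impI)
    fix a b c d e
    assume dist: "distinct [a, b, c, d, e]" and A: "{a, b, c, d, e} = A"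
    note [simp del] = edge.simps
    have Q: "before a c b e d = before a c b d e"
      using dist by (intro before_commute) auto
    have step: "h (u @ [x, y] @ v) - h (u @ [y, x] @ v) = edge u x y v"
      if "distinct (u @ [x, y] @ v)" "set (u @ [x, y] @ v) = {a, b, c, d, e}" for u x y v
      using h that A by simp
    have "h [a, b, c, d, e] - h [b, a, c, d, e] = L a b c d e - L b a c d e + after a b c d e"
      using step[of "[]" a b "[c, d, e]"] dist by (auto simp: edge.simps)
    moreover have "h [d, a, b, c, e] - h [d, b, a, c, e] = M d a b c e - M d b a c e + after a b c d e"
      using step[of "[d]" a b "[c, e]"] dist by (auto simp: edge.simps)
    moreover have "h [d, e, a, b, c] - h [d, e, b, a, c] = R d e a b c - R d e b a c + after a b c d e"
      using step[of "[d, e]" a b "[c]"] edge2[of a b d e c] dist by auto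
    moreover have "h [b, a, c, d, e] - h [b, c, a, d, e] = L b a c d e - L b c a d e + before a c b d e"
      using step[of "[b]" a c "[d, e]"] edge1[of b a c d e] dist by auto
    moreover have "h [d, b, a, c, e] - h [d, b, c, a, e] = M d b a c e - M d b c a e + before a c b d e"
      using step[of "[d, b]" a c "[e]"] dist by (auto simp: edge.simps)
    moreover have "h [d, e, b, a, c] - h [d, e, b, c, a] = R d e b a c - R d e b c a + before a c b d e"
      using step[of "[d, e, b]" a c "[]"] dist by (auto simp: edge.simps)
    ultimately show "- after a b c e d = - after a b c d e \<and>
      - after a b c e d - before a c b e d = - after a b c d e - before a c b d e \<and>
      cL a b c d e = h [a, b, c, d, e] - h [b, a, c, d, e] + - after a b c d e \<and>
      cM d a b c e = h [d, a, b, c, e] - h [d, b, a, c, e] + - after a b c d e \<and>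
      cR d e a b c = h [d, e, a, b, c] - h [d, e, b, a, c] + - after a b c d e \<and>
      tL a b c d e = h [a, b, c, d, e] - h [b, c, a, d, e] + (- after a b c d e - before a c b d e) \<and>
      tM d a b c e = h [d, a, b, c, e] - h [d, b, c, a, e] + (- after a b c d e - before a c b d e) \<and>
      tR d e a b c = h [d, e, a, b, c] - h [d, e, b, c, a] + (- after a b c d e - before a c b d e)"
      unfolding cL_def cM_def cR_def tL_def tM_def tR_def after_commute[of a b c e d] Q
      by (intro conjI refl; algebra)
  qed
qed

end

section \<open>Splitting a comtrans pair into a single operation\<close>

text \<open>The predicate \<open>S\<close> restricts the relations to those triples, closed under permutation, for which the
monomials involved are multilinear.\<close>

locale comtrans_pair =
  fixes S :: "'m \<Rightarrow> 'm \<Rightarrow> 'm \<Rightarrow> bool" and C T :: "'m \<Rightarrow> 'm \<Rightarrow> 'm \<Rightarrow> 'k::field_char_0"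
  assumes swap: "S x y z \<Longrightarrow> S y x z" and rotate: "S x y z \<Longrightarrow> S y z x"
    and skew: "S x y z \<Longrightarrow> C x y z + C y x z = 0"
    and cyclic: "S x y z \<Longrightarrow> T x y z + T y z x + T z x y = 0"
    and comtrans: "S x y z \<Longrightarrow> C x y z + C z y x = T x y z + T z y x"
begin

text \<open>If \<open>C\<close> and \<open>T\<close> do come from an operation \<open>xyz\<close>, this is \<open>xyz\<close> minus the mean of the six products of
\<open>x\<close>, \<open>y\<close>, \<open>z\<close>: adding a symmetric function to \<open>xyz\<close> changes neither \<open>C\<close> nor \<open>T\<close>, and the mean is
the canonical choice.\<close>

definition "word x y z = (3 * C x y z + T x y z - T z x y - T z y x + T y x z) / 6"

lemma C_word: assumes "S x y z" shows "C x y z = word x y z - word y x z"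
proof -
  have "6 * word x y z = 3 * C x y z + T x y z - T z x y - T z y x + T y x z"
    "6 * word y x z = 3 * C y x z + T y x z - T z y x - T z x y + T x y z"
    by (simp_all add: word_def)
  then have "6 * (C x y z - (word x y z - word y x z)) = 0"
    using skew[OF assms] by algebra
  then show ?thesis by (metis mult_eq_0_iff zero_neq_numeral right_minus_eq)
qed

lemma T_word: assumes "S x y z" shows "T x y z = word x y z - word y z x"
proof -
  have S: "S y z x" "S z x y" "S y x z" "S x z y" "S z y x"
    using assms swap rotate by blast+
  have "6 * word x y z = 3 * C x y z + T x y z - T z x y - T z y x + T y x z"
    "6 * word y z x = 3 * C y z x + T y z x - T x y z - T x z y + T z y x"
    by (simp_all add: word_def)
  then have "6 * (T x y z - (word x y z - word y z x)) = 0"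
    using skew[OF S(1)] cyclic[OF assms] cyclic[OF S(3)] comtrans[OF assms] by algebra
  then show ?thesis by (metis mult_eq_0_iff zero_neq_numeral right_minus_eq)
qed

end

lemma trilin_ext_diff:
  "trilin_ext p (f - f') g h = trilin_ext p f g h - trilin_ext p f' g h"
  "trilin_ext p f (g - g') h = trilin_ext p f g h - trilin_ext p f g' h"
  "trilin_ext p f g (h - h') = trilin_ext p f g h - trilin_ext p f g h'"
  using trilin_ext_linear(1)[of p "f - f'" f' g h] trilin_ext_linear(2)[of p f "g - g'" g' h]
    trilin_ext_linear(3)[of p f g "h - h'" h'] by (simp_all add: algebra_simps)

lemmas com_tra_simps = com_def tra_def trilin_ext_linear(1-3) trilin_ext_diff trilin_ext_single

lemma lin_ext_pm_simps:
  "lin_ext pm_scale \<psi> (f + g) = lin_ext pm_scale \<psi> f + lin_ext pm_scale \<psi> g"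
  "lin_ext pm_scale \<psi> (f - g) = lin_ext pm_scale \<psi> f - lin_ext pm_scale \<psi> g"
  "lin_ext pm_scale \<psi> (Poly_Mapping.single t 1) = \<psi> t"
proof -
  show add: "lin_ext pm_scale \<psi> (f + g) = lin_ext pm_scale \<psi> f + lin_ext pm_scale \<psi> g" for f g
    by (simp add: pm_lin_ext)
  show "lin_ext pm_scale \<psi> (f - g) = lin_ext pm_scale \<psi> f - lin_ext pm_scale \<psi> g"
    using add[of "f - g" g] by (simp add: algebra_simps)
qed (simp add: pm_lin_ext)

lemma ct_subst_simps:
  "ct_subst \<sigma> (f + g) = ct_subst \<sigma> f + ct_subst \<sigma> g"
  "ct_subst \<sigma> (f - g) = ct_subst \<sigma> f - ct_subst \<sigma> g"
  "ct_subst \<sigma> (mon t) = mon (mono_subst \<sigma> t)"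
  by (simp_all add: ct_subst_def lin_ext_pm_simps)

lemma multilinear_on_add: "multilinear_on X f \<Longrightarrow> multilinear_on X g \<Longrightarrow> multilinear_on X (f + g)"
  unfolding multilinear_on_def using Poly_Mapping.keys_add[of f g] by blast

lemma multilinear_on_diff: "multilinear_on X f \<Longrightarrow> multilinear_on X g \<Longrightarrow> multilinear_on X (f - g)"
  unfolding multilinear_on_def using keys_diff[of f g] by blast

lemma multilinear_on_mon: "distinct (leaves t) \<Longrightarrow> set (leaves t) = X \<Longrightarrow> multilinear_on X (mon t)"
  by (simp add: multilinear_on_def)

lemmas multilinear_on_intros = multilinear_on_add multilinear_on_diff multilinear_on_mon

text \<open>A basis of the span of \<open>N\<close> stays independent when \<open>f\<close> is added, so a linear map may be prescribed
on it.\<close>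

lemma separating_functional:
  assumes "f \<notin> pm.span N"
  obtains \<phi> :: "('b \<Rightarrow>\<^sub>0 'k::field) \<Rightarrow> 'k" where "Vector_Spaces.linear pm_scale (*) \<phi>"
    "\<And>g. g \<in> N \<Longrightarrow> \<phi> g = 0" "\<phi> f = 1"
proof -
  interpret vector_space_pair "pm_scale :: 'k \<Rightarrow> ('b \<Rightarrow>\<^sub>0 'k) \<Rightarrow> _" "(*) :: 'k \<Rightarrow> 'k \<Rightarrow> 'k"
    by unfold_locales (auto simp: algebra_simps)
  obtain B where B: "B \<subseteq> pm.span N" "pm.independent B" "pm.span N \<subseteq> pm.span B"
    using pm.maximal_independent_subset[of "pm.span N"] by blast
  have "f \<notin> pm.span B" using assms B(1) pm.span_minimal[OF B(1) pm.subspace_span] by blast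
  then have "pm.independent (insert f B)" using B(2) by (simp add: pm.independent_insertI)
  from linear_independent_extend[OF this, of "\<lambda>g. if g = f then 1 else 0"]
  obtain \<phi> where \<phi>: "Vector_Spaces.linear pm_scale (*) \<phi>"
    "\<And>g. g \<in> insert f B \<Longrightarrow> \<phi> g = (if g = f then 1 else 0)" by blast
  have "\<phi> g = 0" if "g \<in> N" for g
  proof (rule linear_eq_0_on_span[OF \<phi>(1)])
    show "g \<in> pm.span B" using that B(3) pm.span_base by blast
    show "\<phi> b = 0" if "b \<in> B" for b
      using \<phi>(2)[of b] that \<open>f \<notin> pm.span B\<close> pm.span_base by auto
  qed
  with \<phi> that show thesis by auto
qed

section \<open>Functionals vanishing on the consequences\<close>

locale identity_functional =
  fixes \<phi> :: "'k::field_char_0 ct_poly \<Rightarrow> 'k"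
  assumes linear: "Vector_Spaces.linear pm_scale (*) \<phi>"
    and consequences_0: "g \<in> consequences defining_identities \<Longrightarrow> \<phi> g = 0"
begin

abbreviation "val t \<equiv> \<phi> (mon t)"

lemma \<phi>_add: "\<phi> (f + g) = \<phi> f + \<phi> g"
  using linear by (simp add: Vector_Spaces.linear_iff)

lemma \<phi>_diff: "\<phi> (f - g) = \<phi> f - \<phi> g"
  using \<phi>_add[of "f - g" g] by (simp add: algebra_simps)

lemma subst_0:
  "g \<in> defining_identities \<Longrightarrow> multilinear (ct_subst \<sigma> g) \<Longrightarrow> \<phi> (ct_subst \<sigma> g) = 0"
  by (intro consequences_0 consequences.subst consequences.base)

text \<open>The three comtrans identities at arbitrary monomials.\<close>

definition skew_element where "skew_element x y z = mon (Com x y z) + mon (Com y x z)"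
definition cyclic_element where "cyclic_element x y z = mon (Tra x y z) + mon (Tra y z x) + mon (Tra z x y)"
definition comtrans_element where
  "comtrans_element x y z = (mon (Com x y z) + mon (Com z y x)) - (mon (Tra x y z) + mon (Tra z y x))"

lemmas comtrans_element_defs = skew_element_def cyclic_element_def comtrans_element_def

lemma comtrans_element:
  assumes "distinct (leaves x @ leaves y @ leaves z)"
    and "g \<in> {skew_element x y z, cyclic_element x y z, comtrans_element x y z}"
  shows "g \<in> consequences defining_identities"
proof -
  let ?\<sigma> = "\<lambda>i. [x, y, z] ! i"
  have ml: "multilinear (skew_element x y z)" "multilinear (cyclic_element x y z)" "multilinear (comtrans_element x y z)"
    unfolding multilinear_def comtrans_element_defs
    by (rule exI[of _ "set (leaves x @ leaves y @ leaves z)"],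
        use assms(1) in \<open>intro multilinear_on_intros; auto\<close>)+
  have "\<exists>g'\<in>comtrans_identities. g = ct_subst ?\<sigma> g'"
    using assms(2) unfolding comtrans_identities_def Let_def com_tra_simps comtrans_element_defs
    by (auto simp: ct_subst_simps numeral_2_eq_2)
  then obtain g' where "g' \<in> defining_identities" "g = ct_subst ?\<sigma> g'"
    by (auto simp: defining_identities_def)
  with ml assms(2) show ?thesis
    by (auto intro: consequences.subst consequences.base)
qed

definition contexts :: "monomial \<Rightarrow> monomial \<Rightarrow> (monomial \<Rightarrow> monomial) set" where
  "contexts s t = {\<lambda>m. Com m s t, \<lambda>m. Com s m t, \<lambda>m. Com s t m,
    \<lambda>m. Tra m s t, \<lambda>m. Tra s m t, \<lambda>m. Tra s t m}"

lemma comtrans_0: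
  assumes "distinct (leaves x @ leaves y @ leaves z)"
  shows "val (Com x y z) + val (Com y x z) = 0"
    "val (Tra x y z) + val (Tra y z x) + val (Tra z x y) = 0"
    "val (Com x y z) + val (Com z y x) = val (Tra x y z) + val (Tra z y x)"
proof -
  have "\<phi> (skew_element x y z) = 0" "\<phi> (cyclic_element x y z) = 0" "\<phi> (comtrans_element x y z) = 0"
    using comtrans_element[OF assms, THEN consequences_0] by blast+
  then show "val (Com x y z) + val (Com y x z) = 0"
    "val (Tra x y z) + val (Tra y z x) + val (Tra z x y) = 0"
    "val (Com x y z) + val (Com z y x) = val (Tra x y z) + val (Tra z y x)"
    by (simp_all add: comtrans_element_defs \<phi>_add \<phi>_diff)
qed

lemma insertion_0:
  assumes "K \<in> contexts s t" "g \<in> consequences defining_identities"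
    "multilinear (lin_ext pm_scale (\<lambda>m. mon (K m)) g)"
  shows "\<phi> (lin_ext pm_scale (\<lambda>m. mon (K m)) g) = 0"
proof (rule consequences_0)
  have "lin_ext pm_scale (\<lambda>m. mon (K m)) g \<in>
      {[g, mon s, mon t]\<^sub>c, [mon s, g, mon t]\<^sub>c, [mon s, mon t, g]\<^sub>c,
       \<langle>g, mon s, mon t\<rangle>, \<langle>mon s, g, mon t\<rangle>, \<langle>mon s, mon t, g\<rangle>}"
    using assms(1) by (auto simp: contexts_def com_def tra_def trilin_ext_def pm_lin_ext)
  with assms(2,3) show "lin_ext pm_scale (\<lambda>m. mon (K m)) g \<in> consequences defining_identities"
    by (elim insertE emptyE; metis consequences.intros)
qed

lemma inserted_comtrans_0:
  assumes dist: "distinct (leaves x @ leaves y @ leaves z @ leaves s @ leaves t)"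
    and K: "K \<in> contexts s t"
  shows "val (K (Com x y z)) + val (K (Com y x z)) = 0"
    "val (K (Tra x y z)) + val (K (Tra y z x)) + val (K (Tra z x y)) = 0"
    "val (K (Com x y z)) + val (K (Com z y x)) = val (K (Tra x y z)) + val (K (Tra z y x))"
proof -
  let ?X = "set (leaves x @ leaves y @ leaves z @ leaves s @ leaves t)"
  have ml: "multilinear_on ?X (mon (K u))"
    if "u \<in> {Com x y z, Com y x z, Com z y x, Tra x y z, Tra y z x, Tra z x y, Tra z y x}" for u
    using K that dist by (intro multilinear_on_mon) (auto simp: contexts_def)
  have "\<phi> (lin_ext pm_scale (\<lambda>m. mon (K m)) g) = 0"
    if "g \<in> {skew_element x y z, cyclic_element x y z, comtrans_element x y z}" for g
  proof (rule insertion_0[OF K])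
    show "g \<in> consequences defining_identities"
      using comtrans_element[OF _ that] dist by auto
    have "multilinear_on ?X (lin_ext pm_scale (\<lambda>m. mon (K m)) g)"
      using that by (elim insertE emptyE; simp only: comtrans_element_defs lin_ext_pm_simps;
          intro multilinear_on_intros(1,2) ml; simp)
    then show "multilinear (lin_ext pm_scale (\<lambda>m. mon (K m)) g)"
      unfolding multilinear_def by blast
  qed
  then have "\<phi> (lin_ext pm_scale (\<lambda>m. mon (K m)) (skew_element x y z)) = 0"
    "\<phi> (lin_ext pm_scale (\<lambda>m. mon (K m)) (cyclic_element x y z)) = 0"
    "\<phi> (lin_ext pm_scale (\<lambda>m. mon (K m)) (comtrans_element x y z)) = 0"
    by blast+
  then show "val (K (Com x y z)) + val (K (Com y x z)) = 0"
    "val (K (Tra x y z)) + val (K (Tra y z x)) + val (K (Tra z x y)) = 0"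
    "val (K (Com x y z)) + val (K (Com z y x)) = val (K (Tra x y z)) + val (K (Tra z y x))"
    by (simp_all add: comtrans_element_defs lin_ext_pm_simps \<phi>_add \<phi>_diff)
qed

sublocale outer: comtrans_pair "\<lambda>x y z. distinct (leaves x @ leaves y @ leaves z)"
  "\<lambda>x y z. val (Com x y z)" "\<lambda>x y z. val (Tra x y z)"
  by unfold_locales (auto simp: comtrans_0)

text \<open>Each of the three outer words is a combination of outer commutators and translators, hence a
combination of insertions into a monomial, and the comtrans relations for the inner product survive
all of these.\<close>

lemma inner_comtrans_pair:
  assumes "k \<in> {\<lambda>m. outer.word m s t, \<lambda>m. outer.word s m t, \<lambda>m. outer.word s t m}"
  shows "comtrans_pair (\<lambda>x y z. distinct (leaves x @ leaves y @ leaves z @ leaves s @ leaves t))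
    (\<lambda>x y z. k (Com x y z)) (\<lambda>x y z. k (Tra x y z))"
proof
  fix x y z
  assume dist: "distinct (leaves x @ leaves y @ leaves z @ leaves s @ leaves t)"
  then show "distinct (leaves y @ leaves x @ leaves z @ leaves s @ leaves t)"
    "distinct (leaves y @ leaves z @ leaves x @ leaves s @ leaves t)" by auto
  have "distinct (leaves x @ leaves y @ leaves z @ leaves t @ leaves s)"
    using dist by auto
  then have rel: "val (K (Com x y z)) + val (K (Com y x z)) = 0"
    "val (K (Tra x y z)) + val (K (Tra y z x)) + val (K (Tra z x y)) = 0"
    "val (K (Com x y z)) + val (K (Com z y x)) = val (K (Tra x y z)) + val (K (Tra z y x))"
    if "K \<in> contexts s t \<union> contexts t s" for K
    using that inserted_comtrans_0[OF dist, of K] inserted_comtrans_0[of x y z t s K] by auto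
  obtain K K1 K2 K3 K4 where
    K: "K \<in> contexts s t \<union> contexts t s" "K1 \<in> contexts s t \<union> contexts t s"
      "K2 \<in> contexts s t \<union> contexts t s" "K3 \<in> contexts s t \<union> contexts t s"
      "K4 \<in> contexts s t \<union> contexts t s" and
    k: "k = (\<lambda>m. (3 * val (K m) + val (K1 m) - val (K2 m) - val (K3 m) + val (K4 m)) / 6)"
  proof -
    from assms consider "k = (\<lambda>m. outer.word m s t)" | "k = (\<lambda>m. outer.word s m t)"
      | "k = (\<lambda>m. outer.word s t m)" by blast
    then show thesis
    proof cases
      case 1
      then show thesis
        by (intro that[of "\<lambda>m. Com m s t" "\<lambda>m. Tra m s t" "\<lambda>m. Tra t m s" "\<lambda>m. Tra t s m" "\<lambda>m. Tra s m t"])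
          (simp_all add: contexts_def outer.word_def)
    next
      case 2
      then show thesis
        by (intro that[of "\<lambda>m. Com s m t" "\<lambda>m. Tra s m t" "\<lambda>m. Tra t s m" "\<lambda>m. Tra t m s" "\<lambda>m. Tra m s t"])
          (simp_all add: contexts_def outer.word_def)
    next
      case 3
      then show thesis
        by (intro that[of "\<lambda>m. Com s t m" "\<lambda>m. Tra s t m" "\<lambda>m. Tra m s t" "\<lambda>m. Tra m t s" "\<lambda>m. Tra t s m"])
          (simp_all add: contexts_def outer.word_def)
    qed
  qed
  have 6: "6 * k m = 3 * val (K m) + val (K1 m) - val (K2 m) - val (K3 m) + val (K4 m)" for m
    by (simp add: k)
  have "6 * (k (Com x y z) + k (Com y x z)) = 0"
    "6 * (k (Tra x y z) + k (Tra y z x) + k (Tra z x y)) = 0"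
    "6 * (k (Com x y z) + k (Com z y x) - (k (Tra x y z) + k (Tra z y x))) = 0"
    unfolding distrib_left right_diff_distrib 6
    using K[THEN rel(1)] K[THEN rel(2)] K[THEN rel(3)] by algebra+
  then show "k (Com x y z) + k (Com y x z) = 0"
    "k (Tra x y z) + k (Tra y z x) + k (Tra z x y) = 0"
    "k (Com x y z) + k (Com z y x) = k (Tra x y z) + k (Tra z y x)"
    by (metis mult_eq_0_iff zero_neq_numeral right_minus_eq)+
qed

text \<open>The outer product is split into words first, then the inner one.\<close>

definition "L a b c d e = comtrans_pair.word (\<lambda>x y z. outer.word (Com x y z) (Var d) (Var e))
  (\<lambda>x y z. outer.word (Tra x y z) (Var d) (Var e)) (Var a) (Var b) (Var c)"
definition "M d a b c e = comtrans_pair.word (\<lambda>x y z. outer.word (Var d) (Com x y z) (Var e))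
  (\<lambda>x y z. outer.word (Var d) (Tra x y z) (Var e)) (Var a) (Var b) (Var c)"
definition "R d e a b c = comtrans_pair.word (\<lambda>x y z. outer.word (Var d) (Var e) (Com x y z))
  (\<lambda>x y z. outer.word (Var d) (Var e) (Tra x y z)) (Var a) (Var b) (Var c)"

sublocale bracketed_words L M R .

lemma word_inner:
  assumes "distinct [a, b, c, d, e]"
  shows "outer.word (Com (Var a) (Var b) (Var c)) (Var d) (Var e) = cL a b c d e"
    "outer.word (Tra (Var a) (Var b) (Var c)) (Var d) (Var e) = tL a b c d e"
    "outer.word (Var d) (Com (Var a) (Var b) (Var c)) (Var e) = cM d a b c e"
    "outer.word (Var d) (Tra (Var a) (Var b) (Var c)) (Var e) = tM d a b c e"
    "outer.word (Var d) (Var e) (Com (Var a) (Var b) (Var c)) = cR d e a b c"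
    "outer.word (Var d) (Var e) (Tra (Var a) (Var b) (Var c)) = tR d e a b c"
proof -
  have d: "distinct (leaves (Var a) @ leaves (Var b) @ leaves (Var c) @ leaves (Var d) @ leaves (Var e))"
    using assms by simp
  note pairs = inner_comtrans_pair[of _ "Var d" "Var e"]
  show "outer.word (Com (Var a) (Var b) (Var c)) (Var d) (Var e) = cL a b c d e"
    "outer.word (Tra (Var a) (Var b) (Var c)) (Var d) (Var e) = tL a b c d e"
    unfolding cL_def tL_def L_def
    using comtrans_pair.C_word[OF pairs d, of "\<lambda>m. outer.word m (Var d) (Var e)"]
      comtrans_pair.T_word[OF pairs d, of "\<lambda>m. outer.word m (Var d) (Var e)"] by simp_all
  show "outer.word (Var d) (Com (Var a) (Var b) (Var c)) (Var e) = cM d a b c e"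
    "outer.word (Var d) (Tra (Var a) (Var b) (Var c)) (Var e) = tM d a b c e"
    unfolding cM_def tM_def M_def
    using comtrans_pair.C_word[OF pairs d, of "\<lambda>m. outer.word (Var d) m (Var e)"]
      comtrans_pair.T_word[OF pairs d, of "\<lambda>m. outer.word (Var d) m (Var e)"] by simp_all
  show "outer.word (Var d) (Var e) (Com (Var a) (Var b) (Var c)) = cR d e a b c"
    "outer.word (Var d) (Var e) (Tra (Var a) (Var b) (Var c)) = tR d e a b c"
    unfolding cR_def tR_def R_def
    using comtrans_pair.C_word[OF pairs d, of "\<lambda>m. outer.word (Var d) (Var e) m"]
      comtrans_pair.T_word[OF pairs d, of "\<lambda>m. outer.word (Var d) (Var e) m"] by simp_all
qed

lemma val_monomials:
  assumes "distinct [a, b, c, d, e]"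
  shows "val (Com (Com (Var a) (Var b) (Var c)) (Var d) (Var e)) = cL a b c d e - cM d a b c e"
    "val (Com (Var d) (Com (Var a) (Var b) (Var c)) (Var e)) = cM d a b c e - cL a b c d e"
    "val (Com (Var d) (Var e) (Com (Var a) (Var b) (Var c))) = cR d e a b c - cR e d a b c"
    "val (Com (Tra (Var a) (Var b) (Var c)) (Var d) (Var e)) = tL a b c d e - tM d a b c e"
    "val (Com (Var d) (Tra (Var a) (Var b) (Var c)) (Var e)) = tM d a b c e - tL a b c d e"
    "val (Com (Var d) (Var e) (Tra (Var a) (Var b) (Var c))) = tR d e a b c - tR e d a b c"
    "val (Tra (Com (Var a) (Var b) (Var c)) (Var d) (Var e)) = cL a b c d e - cR d e a b c"
    "val (Tra (Var d) (Com (Var a) (Var b) (Var c)) (Var e)) = cM d a b c e - cL a b c e d"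
    "val (Tra (Var d) (Var e) (Com (Var a) (Var b) (Var c))) = cR d e a b c - cM e a b c d"
    "val (Tra (Tra (Var a) (Var b) (Var c)) (Var d) (Var e)) = tL a b c d e - tR d e a b c"
    "val (Tra (Var d) (Tra (Var a) (Var b) (Var c)) (Var e)) = tM d a b c e - tL a b c e d"
    "val (Tra (Var d) (Var e) (Tra (Var a) (Var b) (Var c))) = tR d e a b c - tM e a b c d"
proof -
  have e: "distinct [a, b, c, e, d]" using assms by auto
  note w = word_inner[OF assms] word_inner[OF e]
  note o = outer.C_word outer.T_word
  show "val (Com (Com (Var a) (Var b) (Var c)) (Var d) (Var e)) = cL a b c d e - cM d a b c e"
    "val (Com (Var d) (Com (Var a) (Var b) (Var c)) (Var e)) = cM d a b c e - cL a b c d e"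
    "val (Com (Var d) (Var e) (Com (Var a) (Var b) (Var c))) = cR d e a b c - cR e d a b c"
    "val (Com (Tra (Var a) (Var b) (Var c)) (Var d) (Var e)) = tL a b c d e - tM d a b c e"
    "val (Com (Var d) (Tra (Var a) (Var b) (Var c)) (Var e)) = tM d a b c e - tL a b c d e"
    "val (Com (Var d) (Var e) (Tra (Var a) (Var b) (Var c))) = tR d e a b c - tR e d a b c"
    "val (Tra (Com (Var a) (Var b) (Var c)) (Var d) (Var e)) = cL a b c d e - cR d e a b c"
    "val (Tra (Var d) (Com (Var a) (Var b) (Var c)) (Var e)) = cM d a b c e - cL a b c e d"
    "val (Tra (Var d) (Var e) (Com (Var a) (Var b) (Var c))) = cR d e a b c - cM e a b c d"
    "val (Tra (Tra (Var a) (Var b) (Var c)) (Var d) (Var e)) = tL a b c d e - tR d e a b c"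
    "val (Tra (Var d) (Tra (Var a) (Var b) (Var c)) (Var e)) = tM d a b c e - tL a b c e d"
    "val (Tra (Var d) (Var e) (Tra (Var a) (Var b) (Var c))) = tR d e a b c - tM e a b c d"
    unfolding w[symmetric] by (rule o; use assms in auto)+
qed

end

section \<open>Identities of degree five\<close>

context identity_functional
begin

lemma identities_0:
  assumes "distinct [v, w, x, y, z]"
  shows "com_id v w x y z = 0" "tra_id v w x y z = 0"
    "mixed1 v w x y z = 0" "mixed2 v w x y z = 0" "mixed3 v w x y z = 0"
proof -
  let ?\<sigma> = "\<lambda>i. Var ([v, w, x, y, z] ! i)"
  let ?X = "{v, w, x, y, z}"
  have "multilinear_on ?X (ct_subst ?\<sigma> commutator_identity :: 'k ct_poly)"
    unfolding commutator_identity_def Let_def ct_T_def com_tra_simps ct_subst_simps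
    by (intro multilinear_on_intros; use assms in auto)
  moreover have "multilinear_on ?X (ct_subst ?\<sigma> translator_identity :: 'k ct_poly)"
    unfolding translator_identity_def Let_def ct_R_def com_tra_simps ct_subst_simps
    by (intro multilinear_on_intros; use assms in auto)
  moreover have "\<forall>g\<in>mixed_identities. multilinear_on ?X (ct_subst ?\<sigma> g :: 'k ct_poly)"
    unfolding mixed_identities_def Let_def com_tra_simps ct_subst_simps ball_simps
    by (intro conjI TrueI multilinear_on_intros; use assms in auto)
  ultimately have "\<forall>g\<in>{commutator_identity, translator_identity} \<union> mixed_identities.
      \<phi> (ct_subst ?\<sigma> g) = 0"
    using subst_0[of _ ?\<sigma>] unfolding multilinear_def defining_identities_def by blast
  then have eqs: "\<phi> (ct_subst ?\<sigma> commutator_identity) = 0" "\<phi> (ct_subst ?\<sigma> translator_identity) = 0"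
    "\<forall>g\<in>mixed_identities. \<phi> (ct_subst ?\<sigma> g) = 0"
    by blast+
  note d = distinct_both_ways[OF assms]
  show "com_id v w x y z = 0"
    using eqs(1) d
    unfolding commutator_identity_def Let_def ct_T_def com_tra_simps ct_subst_simps
    by (simp add: \<phi>_add \<phi>_diff val_monomials com_id_def com_T_def)
  show "tra_id v w x y z = 0"
    using eqs(2) d
    unfolding translator_identity_def Let_def ct_R_def com_tra_simps ct_subst_simps
    by (simp add: \<phi>_add \<phi>_diff val_monomials tra_id_def diff_diff_eq)
  show "mixed1 v w x y z = 0" "mixed2 v w x y z = 0" "mixed3 v w x y z = 0"
    using eqs(3) d
    unfolding mixed_identities_def Let_def com_tra_simps ct_subst_simps ball_simps
    by (simp_all add: \<phi>_add \<phi>_diff val_monomials mixed1_def mixed2_def mixed3_def)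
qed

sublocale comtrans_words L M R
  by unfold_locales (rule identities_0, assumption)+

end

text \<open>Degrees of monomials are odd, so a monomial of degree five is one operation inserted into another.\<close>

lemma length_leaves: "odd (length (leaves t))"
  by (induction t) auto

lemma leaves_1: assumes "length (leaves t) = 1" shows "\<exists>a. t = Var a"
proof (cases t)
  case (Com r s u)
  then show ?thesis using assms odd_pos[OF length_leaves[of r]] odd_pos[OF length_leaves[of s]] by simp
next
  case (Tra r s u)
  then show ?thesis using assms odd_pos[OF length_leaves[of r]] odd_pos[OF length_leaves[of s]] by simp
qed auto

lemma leaves_operation:
  assumes "length (leaves t) > 1"
  shows "\<exists>F\<in>{Com, Tra}. \<exists>r s u. t = F r s u
    \<and> length (leaves r) + length (leaves s) + length (leaves u) = length (leaves t)"
  using assms by (cases t) auto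

lemma leaves_3: assumes "length (leaves t) = 3"
  shows "\<exists>F\<in>{Com, Tra}. \<exists>a b c. t = F (Var a) (Var b) (Var c)"
proof -
  obtain F r s u where F: "F \<in> {Com, Tra}" "t = F r s u"
    "length (leaves r) + length (leaves s) + length (leaves u) = 3"
    using assms leaves_operation[of t] by force
  then have "length (leaves r) = 1 \<and> length (leaves s) = 1 \<and> length (leaves u) = 1"
    using odd_pos[OF length_leaves[of r]] odd_pos[OF length_leaves[of s]] odd_pos[OF length_leaves[of u]]
    by linarith
  with F(1,2) show ?thesis using leaves_1 by blast
qed

lemma leaves_5:
  assumes "length (leaves t) = 5"
  obtains F G a b c d e where "F \<in> {Com, Tra}" "G \<in> {Com, Tra}"
    "t = G (F (Var a) (Var b) (Var c)) (Var d) (Var e) \<or> t = G (Var d) (F (Var a) (Var b) (Var c)) (Var e)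
      \<or> t = G (Var d) (Var e) (F (Var a) (Var b) (Var c))"
proof -
  obtain G r s u where G: "G \<in> {Com, Tra}" "t = G r s u"
    "length (leaves r) + length (leaves s) + length (leaves u) = 5"
    using assms leaves_operation[of t] by force
  have "length (leaves r) = 3 \<and> length (leaves s) = 1 \<and> length (leaves u) = 1 \<or>
    length (leaves r) = 1 \<and> length (leaves s) = 3 \<and> length (leaves u) = 1 \<or>
    length (leaves r) = 1 \<and> length (leaves s) = 1 \<and> length (leaves u) = 3"
    using G(3) length_leaves[of r] length_leaves[of s] length_leaves[of u] by presburger
  then show thesis
  proof (elim disjE conjE)
    assume "length (leaves r) = 3" "length (leaves s) = 1" "length (leaves u) = 1"
    then obtain F a b c d e where "F \<in> {Com, Tra}" "r = F (Var a) (Var b) (Var c)" "s = Var d" "u = Var e"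
      using leaves_3 leaves_1 by meson
    with G(1,2) show thesis by (intro that[of F G a b c d e]) simp_all
  next
    assume "length (leaves r) = 1" "length (leaves s) = 3" "length (leaves u) = 1"
    then obtain F a b c d e where "F \<in> {Com, Tra}" "s = F (Var a) (Var b) (Var c)" "r = Var d" "u = Var e"
      using leaves_3 leaves_1 by meson
    with G(1,2) show thesis by (intro that[of F G a b c d e]) simp_all
  next
    assume "length (leaves r) = 1" "length (leaves s) = 1" "length (leaves u) = 3"
    then obtain F a b c d e where "F \<in> {Com, Tra}" "u = F (Var a) (Var b) (Var c)" "r = Var d" "s = Var e"
      using leaves_3 leaves_1 by meson
    with G(1,2) show thesis by (intro that[of F G a b c d e]) simp_all
  qed
qed

abbreviation "word_of \<equiv> mono_eval free_triple (\<lambda>i. Poly_Mapping.single [i] 1)"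

lemma field_vector_space: "vector_space ((*) :: 'k::field \<Rightarrow> 'k \<Rightarrow> 'k)"
  by unfold_locales (auto simp: algebra_simps)

lemma lin_ext_field_diff:
  "lin_ext (*) h (f - g) = lin_ext (*) h f - lin_ext (*) h g" for h :: "'b \<Rightarrow> 'k::field"
  using lin_ext_add[OF field_vector_space, of h "f - g" g] by (simp add: algebra_simps)

text \<open>The terms \<open>S\<close> and \<open>S'\<close> of the potential cancel in the value of \<open>\<phi>\<close> at a monomial, and what remains
is the value of \<open>h\<close> at its expansion.\<close>

lemma (in identity_functional) factors_through_words:
  assumes "card X = 5"
  shows "\<exists>h. \<forall>t. distinct (leaves t) \<longrightarrow> set (leaves t) = X \<longrightarrow> val t = lin_ext (*) h (word_of t)"
proof -
  obtain h S S' where h: "\<And>a b c d e. distinct [a, b, c, d, e] \<Longrightarrow> {a, b, c, d, e} = X \<Longrightarrow>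
    S a b c e d = S a b c d e \<and> S' a b c e d = S' a b c d e \<and>
    cL a b c d e = h [a, b, c, d, e] - h [b, a, c, d, e] + S a b c d e \<and>
    cM d a b c e = h [d, a, b, c, e] - h [d, b, a, c, e] + S a b c d e \<and>
    cR d e a b c = h [d, e, a, b, c] - h [d, e, b, a, c] + S a b c d e \<and>
    tL a b c d e = h [a, b, c, d, e] - h [b, c, a, d, e] + S' a b c d e \<and>
    tM d a b c e = h [d, a, b, c, e] - h [d, b, c, a, e] + S' a b c d e \<and>
    tR d e a b c = h [d, e, a, b, c] - h [d, e, b, c, a] + S' a b c d e"
    using potential[OF assms] by metis
  have "val t = lin_ext (*) h (word_of t)" if dist: "distinct (leaves t)" and X: "set (leaves t) = X" for t
  proof -
    have "length (leaves t) = 5" using distinct_card[OF dist] X assms by simp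
    then obtain F G a b c d e where FG: "F \<in> {Com, Tra}" "G \<in> {Com, Tra}" and
      t: "t = G (F (Var a) (Var b) (Var c)) (Var d) (Var e) \<or> t = G (Var d) (F (Var a) (Var b) (Var c)) (Var e)
        \<or> t = G (Var d) (Var e) (F (Var a) (Var b) (Var c))"
      by (rule leaves_5)
    have de: "distinct [a, b, c, d, e]" "{a, b, c, d, e} = X"
      using dist X t FG by auto
    then have ed: "distinct [a, b, c, e, d]" "{a, b, c, e, d} = X" by auto
    obtain s s' where s: "S a b c d e = s" "S a b c e d = s" "S' a b c d e = s'" "S' a b c e d = s'"
      using h[OF de] by auto
    note bracketed = val_monomials[OF de(1)] h[OF de, THEN conjunct2, THEN conjunct2, unfolded s]
      h[OF ed, THEN conjunct2, THEN conjunct2, unfolded s]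
    note calculus = special_commutator_def special_translator_def free_triple_def
      trilin_ext_diff trilin_ext_single lin_ext_field_diff lin_ext_single[OF field_vector_space]
    have "val (G (F (Var a) (Var b) (Var c)) (Var d) (Var e))
        = lin_ext (*) h (word_of (G (F (Var a) (Var b) (Var c)) (Var d) (Var e)))
      \<and> val (G (Var d) (F (Var a) (Var b) (Var c)) (Var e))
        = lin_ext (*) h (word_of (G (Var d) (F (Var a) (Var b) (Var c)) (Var e)))
      \<and> val (G (Var d) (Var e) (F (Var a) (Var b) (Var c)))
        = lin_ext (*) h (word_of (G (Var d) (Var e) (F (Var a) (Var b) (Var c))))"
    proof -
      from FG consider "F = Com" "G = Com" | "F = Com" "G = Tra" | "F = Tra" "G = Com" | "F = Tra" "G = Tra"
        by blast
      then show ?thesis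
        by cases (simp_all only: bracketed, simp_all add: calculus)
    qed
    with t show ?thesis by blast
  qed
  then show ?thesis by blast
qed

theorem theorem5p4:
  fixes f :: "'k::field_char_0 ct_poly" and X :: "nat set"
  assumes "card X = 5"
    and "multilinear_on X f"
    and "special_identity TYPE(nat list \<Rightarrow>\<^sub>0 'k) f"
  shows "follows_from defining_identities f"
proof (rule ccontr)
  assume "\<not> follows_from defining_identities f"
  then obtain \<phi> :: "'k ct_poly \<Rightarrow> 'k" where \<phi>: "Vector_Spaces.linear pm_scale (*) \<phi>"
    "\<And>g. g \<in> consequences defining_identities \<Longrightarrow> \<phi> g = 0" "\<phi> f = 1"
    unfolding follows_from_def by (metis separating_functional)
  interpret identity_functional \<phi> using \<phi>(1,2) by (rule identity_functional.intro)
  obtain h where h: "\<And>t. distinct (leaves t) \<Longrightarrow> set (leaves t) = X \<Longrightarrow> val t = lin_ext (*) h (word_of t)"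
    using factors_through_words[OF assms(1)] by blast
  interpret lin: Vector_Spaces.linear pm_scale "(*)" \<phi> by (fact \<phi>(1))
  have f: "f = (\<Sum>t\<in>Poly_Mapping.keys f. pm_scale (Poly_Mapping.lookup f t) (mon t))"
    by (rule poly_mapping_eqI)
      (simp add: lookup_sum lookup_single when_def in_keys_iff if_distrib cong: if_cong)
  interpret hlin: Vector_Spaces.linear pm_scale "(*)" "lin_ext (*) h"
    by unfold_locales (simp_all add: lin_ext_add[OF field_vector_space] lin_ext_scale[OF field_vector_space])
  have "\<phi> f = (\<Sum>t\<in>Poly_Mapping.keys f. Poly_Mapping.lookup f t * val t)"
    by (subst f) (simp add: lin.sum lin.scale)
  also have "\<dots> = (\<Sum>t\<in>Poly_Mapping.keys f. Poly_Mapping.lookup f t * lin_ext (*) h (word_of t))"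
    using assms(2) by (intro sum.cong) (auto simp: multilinear_on_def h)
  also have "\<dots> = lin_ext (*) h (ct_eval pm_scale free_triple (\<lambda>i. Poly_Mapping.single [i] 1) f)"
    by (simp add: ct_eval_def lin_ext_def[of pm_scale] hlin.sum hlin.scale)
  also have "\<dots> = 0"
  proof -
    have "ct_eval pm_scale free_triple (\<lambda>i. Poly_Mapping.single [i] 1) f = 0"
      using assms(3) free_triple_system unfolding special_identity_def by blast
    then show ?thesis by (simp add: lin_ext_def)
  qed
  finally show False using \<phi>(3) by simp
qed

end
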